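(* Let $G$ be the fundamental group of a simply connected finite graph of finitely generated groups, and let $H$ be a finitely generated normal subgroup of $G$ not contained in any edge subgroup. Assume that the intersection of $H$ with any vertex subgroup is finitely generated. Then the distortion $Dist_G^H$ is dominated by the function $f(n)=n\max\{Dist_A^{A\cap H}(n) : A \text{ is a vertex subgroup of } G\}$.
   Context: For functions $f,g$ from $[0,\infty)$ to $[0,\infty]$ (only values at large arguments matter, so functions on $(0,\infty)$ are allowed), $f$ is dominated by $g$, written $f\preceq g$, if there are positive constants $A,B,C,D$ such that $f(x)\le A\,g(Bx)+Cx$ for all $x>D$. Let $G$ be a group with finite generating set $S$ and $H$ a subgroup with finite generating set $T$; $|\cdot|_S$ and $|\cdot|_T$ are the word lengths. The subgroup distortion is $Dist_G^H(r)=\max\{|h|_T : h\in H,\ |h|_S\le r\}$ for $r>0$; up to mutual domination it does not depend on $S$ and $T$. A simply connected finite graph of groups is a graph of groups whose underlying graph is a finite tree. Vertex subgroups and edge subgroups of $G$ are the images in $G$ of the vertex groups and edge groups (one for each vertex, respectively edge, of the finite tree). *)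

theory Defs
  imports
    "HOL-Algebra.Coset"
    "HOL-Algebra.Generated_Groups"
    "HOL-Library.Extended_Nonnegative_Real"
    "Graph_Theory.Graph_Theory"
begin

section \<open>Word length, distortion, domination\<close>

definition finite_generating_set :: "('a, 'b) monoid_scheme \<Rightarrow> 'a set \<Rightarrow> 'a set \<Rightarrow> bool" where
  "finite_generating_set G K S \<longleftrightarrow> finite S \<and> S \<subseteq> K \<and> generate G S = K"

definition finitely_generated :: "('a, 'b) monoid_scheme \<Rightarrow> 'a set \<Rightarrow> bool" where
  "finitely_generated G K \<longleftrightarrow> (\<exists>S. finite_generating_set G K S)"

text \<open>For elements of a subgroup of \<open>G\<close>, word lengths are computed with the operations of \<open>G\<close>,
  which the subgroup inherits.  The value is unspecified outside the subgroup generated by \<open>S\<close>.\<close>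

definition word_length :: "('a, 'b) monoid_scheme \<Rightarrow> 'a set \<Rightarrow> 'a \<Rightarrow> nat" where
  "word_length G S g = (LEAST n. \<exists>ws. length ws = n \<and> set ws \<subseteq> S \<union> m_inv G ` S \<and>
     foldr (\<lambda>x y. x \<otimes>\<^bsub>G\<^esub> y) ws \<one>\<^bsub>G\<^esub> = g)"

text \<open>Distortion in \<open>K\<close> of \<open>H\<close>, where \<open>H \<subseteq> K\<close> are subgroups of \<open>G\<close> with finite generating
  sets \<open>T\<close> and \<open>S\<close>.  For \<open>r > 0\<close> the maximum is over a finite nonempty set, because
  \<open>S\<close> is finite.\<close>

definition distortion ::
  "('a, 'b) monoid_scheme \<Rightarrow> 'a set \<Rightarrow> 'a set \<Rightarrow> 'a set \<Rightarrow> real \<Rightarrow> ennreal" where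
  "distortion G S H T r =
     of_nat (Max {word_length G T h | h. h \<in> H \<and> real (word_length G S h) \<le> r})"

definition dominated :: "(real \<Rightarrow> ennreal) \<Rightarrow> (real \<Rightarrow> ennreal) \<Rightarrow> bool" where
  "dominated f g \<longleftrightarrow> (\<exists>A>0. \<exists>B>0. \<exists>C>0. \<exists>D>0. \<forall>x>D.
     f x \<le> ennreal A * g (B * x) + ennreal (C * x))"


section \<open>Graphs of groups\<close>

text \<open>Graphs are taken in the sense of Serre: each geometric edge is a pair of mutually reverse
  arcs \<open>e\<close>, \<open>reversal e\<close>, sharing one edge group, and \<open>edge_emb e\<close> embeds
  this group in the vertex group at the head of \<open>e\<close>.\<close>

record ('v, 'e, 'g, 'h) graph_of_groups =
  graph_of :: "('v, 'e) pre_digraph"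
  reversal :: "'e \<Rightarrow> 'e"
  vertex_group :: "'v \<Rightarrow> 'g monoid"
  edge_group :: "'e \<Rightarrow> 'h monoid"
  edge_emb :: "'e \<Rightarrow> 'h \<Rightarrow> 'g"

definition is_graph_of_groups :: "('v, 'e, 'g, 'h) graph_of_groups \<Rightarrow> bool" where
  "is_graph_of_groups \<Gamma> \<longleftrightarrow>
     bidirected_digraph (graph_of \<Gamma>) (reversal \<Gamma>) \<and> connected (graph_of \<Gamma>) \<and>
     (\<forall>v \<in> verts (graph_of \<Gamma>). group (vertex_group \<Gamma> v)) \<and>
     (\<forall>e \<in> arcs (graph_of \<Gamma>).
        group (edge_group \<Gamma> e) \<and>
        edge_group \<Gamma> (reversal \<Gamma> e) = edge_group \<Gamma> e \<and>
        edge_emb \<Gamma> e \<in> hom (edge_group \<Gamma> e) (vertex_group \<Gamma> (head (graph_of \<Gamma>) e)) \<and>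
        inj_on (edge_emb \<Gamma> e) (carrier (edge_group \<Gamma> e)))"

text \<open>The library's \<open>cycle\<close> is a directed notion which admits the backtracking cycle
  \<open>[e, reversal e]\<close>; the library's \<open>tree\<close> is therefore not the right notion here.\<close>

definition is_finite_tree :: "('v, 'e) pre_digraph \<Rightarrow> ('e \<Rightarrow> 'e) \<Rightarrow> bool" where
  "is_finite_tree X inv_arc \<longleftrightarrow>
     bidirected_digraph X inv_arc \<and> fin_digraph X \<and> connected X \<and>
     \<not> (\<exists>p. pre_digraph.cycle X p \<and> (\<forall>e \<in> set p. inv_arc e \<notin> set p))"

definition simply_connected_finite_graph_of_groups ::
  "('v, 'e, 'g, 'h) graph_of_groups \<Rightarrow> bool" where
  "simply_connected_finite_graph_of_groups \<Gamma> \<longleftrightarrow>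
     is_graph_of_groups \<Gamma> \<and> is_finite_tree (graph_of \<Gamma>) (reversal \<Gamma>)"


section \<open>The fundamental group\<close>

text \<open>Serre's presentation of the fundamental group relative to (the set \<open>T\<close> of arcs of) a maximal
  subtree: the generators are the elements of the vertex groups and the arcs.
  Words with inverse letters are not needed, because the inverse of each letter is again
  equivalent to a letter.\<close>

datatype ('v, 'e, 'g) letter = Vertex_Letter 'v 'g | Arc_Letter 'e

definition pi1_words :: "('v, 'e, 'g, 'h) graph_of_groups \<Rightarrow> ('v, 'e, 'g) letter list set" where
  "pi1_words \<Gamma> = lists
     ({Vertex_Letter v g | v g. v \<in> verts (graph_of \<Gamma>) \<and> g \<in> carrier (vertex_group \<Gamma> v)} \<union>
      Arc_Letter ` arcs (graph_of \<Gamma>))"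

inductive pi1_eq ::
  "('v, 'e, 'g, 'h) graph_of_groups \<Rightarrow> 'e set \<Rightarrow>
   ('v, 'e, 'g) letter list \<Rightarrow> ('v, 'e, 'g) letter list \<Rightarrow> bool"
  for \<Gamma> T where
  refl: "u \<in> pi1_words \<Gamma> \<Longrightarrow> pi1_eq \<Gamma> T u u"
| sym: "pi1_eq \<Gamma> T u w \<Longrightarrow> pi1_eq \<Gamma> T w u"
| trans: "pi1_eq \<Gamma> T u v \<Longrightarrow> pi1_eq \<Gamma> T v w \<Longrightarrow> pi1_eq \<Gamma> T u w"
| append: "pi1_eq \<Gamma> T u u' \<Longrightarrow> pi1_eq \<Gamma> T w w' \<Longrightarrow> pi1_eq \<Gamma> T (u @ w) (u' @ w')"
| vertex_one: "v \<in> verts (graph_of \<Gamma>) \<Longrightarrow>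
    pi1_eq \<Gamma> T [Vertex_Letter v \<one>\<^bsub>vertex_group \<Gamma> v\<^esub>] []"
| vertex_mult: "v \<in> verts (graph_of \<Gamma>) \<Longrightarrow>
    g \<in> carrier (vertex_group \<Gamma> v) \<Longrightarrow> h \<in> carrier (vertex_group \<Gamma> v) \<Longrightarrow>
    pi1_eq \<Gamma> T [Vertex_Letter v g, Vertex_Letter v h]
      [Vertex_Letter v (g \<otimes>\<^bsub>vertex_group \<Gamma> v\<^esub> h)]"
| reversal: "e \<in> arcs (graph_of \<Gamma>) \<Longrightarrow>
    pi1_eq \<Gamma> T [Arc_Letter e, Arc_Letter (reversal \<Gamma> e)] []"
| edge: "e \<in> arcs (graph_of \<Gamma>) \<Longrightarrow> x \<in> carrier (edge_group \<Gamma> e) \<Longrightarrow>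
    pi1_eq \<Gamma> T
      [Arc_Letter e, Vertex_Letter (head (graph_of \<Gamma>) e) (edge_emb \<Gamma> e x),
       Arc_Letter (reversal \<Gamma> e)]
      [Vertex_Letter (tail (graph_of \<Gamma>) e) (edge_emb \<Gamma> (reversal \<Gamma> e) x)]"
| tree: "e \<in> arcs (graph_of \<Gamma>) \<Longrightarrow> e \<in> T \<Longrightarrow> pi1_eq \<Gamma> T [Arc_Letter e] []"

definition pi1_class ::
  "('v, 'e, 'g, 'h) graph_of_groups \<Rightarrow> 'e set \<Rightarrow>
   ('v, 'e, 'g) letter list \<Rightarrow> ('v, 'e, 'g) letter list set" where
  "pi1_class \<Gamma> T u = {w. pi1_eq \<Gamma> T u w}"

definition pi1 ::
  "('v, 'e, 'g, 'h) graph_of_groups \<Rightarrow> 'e set \<Rightarrow> ('v, 'e, 'g) letter list set monoid" where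
  "pi1 \<Gamma> T =
     \<lparr>carrier = pi1_class \<Gamma> T ` pi1_words \<Gamma>,
      monoid.mult = (\<lambda>X Y. \<Union>u \<in> X. \<Union>w \<in> Y. pi1_class \<Gamma> T (u @ w)),
      one = pi1_class \<Gamma> T []\<rparr>"

text \<open>If the underlying graph is a tree, it is its own unique maximal subtree.\<close>

definition tree_pi1 ::
  "('v, 'e, 'g, 'h) graph_of_groups \<Rightarrow> ('v, 'e, 'g) letter list set monoid" where
  "tree_pi1 \<Gamma> = pi1 \<Gamma> (arcs (graph_of \<Gamma>))"

definition vertex_subgroup ::
  "('v, 'e, 'g, 'h) graph_of_groups \<Rightarrow> 'v \<Rightarrow> ('v, 'e, 'g) letter list set set" where
  "vertex_subgroup \<Gamma> v =
     (\<lambda>g. pi1_class \<Gamma> (arcs (graph_of \<Gamma>)) [Vertex_Letter v g]) ` carrier (vertex_group \<Gamma> v)"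

text \<open>Mutually reverse arcs have the same edge subgroup, by the rules \<open>edge\<close> and \<open>tree\<close> above.\<close>

definition edge_subgroup ::
  "('v, 'e, 'g, 'h) graph_of_groups \<Rightarrow> 'e \<Rightarrow> ('v, 'e, 'g) letter list set set" where
  "edge_subgroup \<Gamma> e =
     (\<lambda>x. pi1_class \<Gamma> (arcs (graph_of \<Gamma>))
        [Vertex_Letter (head (graph_of \<Gamma>) e) (edge_emb \<Gamma> e x)]) ` carrier (edge_group \<Gamma> e)"

lemma pi1_eq_words:
  assumes "is_graph_of_groups \<Gamma>" and "pi1_eq \<Gamma> T u w"
  shows "u \<in> pi1_words \<Gamma> \<and> w \<in> pi1_words \<Gamma>"
proof -
  have bi: "bidirected_digraph (graph_of \<Gamma>) (reversal \<Gamma>)"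
    using assms(1) by (simp add: is_graph_of_groups_def)
  then have wf: "wf_digraph (graph_of \<Gamma>)"
    by (simp add: bidirected_digraph_def)
  have rev: "reversal \<Gamma> e \<in> arcs (graph_of \<Gamma>)" "head (graph_of \<Gamma>) (reversal \<Gamma> e) = tail (graph_of \<Gamma>) e"
    if "e \<in> arcs (graph_of \<Gamma>)" for e
    using bi that bidirected_digraph.arev_in_arcs bidirected_digraph.head_arev by fastforce+
  have vg: "group (vertex_group \<Gamma> v)" if "v \<in> verts (graph_of \<Gamma>)" for v
    using assms(1) that by (simp add: is_graph_of_groups_def)
  have emb: "edge_emb \<Gamma> e x \<in> carrier (vertex_group \<Gamma> (head (graph_of \<Gamma>) e))"
    if "e \<in> arcs (graph_of \<Gamma>)" "x \<in> carrier (edge_group \<Gamma> e)" for e x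
    using assms(1) that by (auto simp: is_graph_of_groups_def hom_def)
  have emb': "edge_emb \<Gamma> (reversal \<Gamma> e) x \<in> carrier (vertex_group \<Gamma> (tail (graph_of \<Gamma>) e))"
    if "e \<in> arcs (graph_of \<Gamma>)" "x \<in> carrier (edge_group \<Gamma> e)" for e x
    using emb[of "reversal \<Gamma> e" x] rev[OF that(1)] that assms(1)
    by (simp add: is_graph_of_groups_def)
  show ?thesis
    using assms(2)
  proof (induction rule: pi1_eq.induct)
    case (edge e x)
    then show ?case
      using emb[OF edge] emb'[OF edge] rev wf_digraph.head_in_verts[OF wf] wf_digraph.tail_in_verts[OF wf]
      by (auto simp: pi1_words_def)
  qed (use rev vg in \<open>auto simp: pi1_words_def group.is_monoid monoid.m_closed monoid.one_closed\<close>)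
qed

lemma pi1_class_eq_iff:
  assumes "u \<in> pi1_words \<Gamma>"
  shows "pi1_class \<Gamma> T u = pi1_class \<Gamma> T w \<longleftrightarrow> pi1_eq \<Gamma> T w u"
proof
  assume "pi1_class \<Gamma> T u = pi1_class \<Gamma> T w"
  then have "u \<in> pi1_class \<Gamma> T w"
    using pi1_eq.refl[OF assms, of T] by (simp add: pi1_class_def set_eq_iff)
  then show "pi1_eq \<Gamma> T w u" by (simp add: pi1_class_def)
next
  assume "pi1_eq \<Gamma> T w u"
  then show "pi1_class \<Gamma> T u = pi1_class \<Gamma> T w"
    unfolding pi1_class_def by (blast intro: pi1_eq.sym pi1_eq.trans)
qed

lemma pi1_mult:
  assumes "u \<in> pi1_words \<Gamma>" "w \<in> pi1_words \<Gamma>"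
  shows "pi1_class \<Gamma> T u \<otimes>\<^bsub>pi1 \<Gamma> T\<^esub> pi1_class \<Gamma> T w = pi1_class \<Gamma> T (u @ w)"
proof -
  have eq: "pi1_class \<Gamma> T (u' @ w') = pi1_class \<Gamma> T (u @ w)"
    if "u' \<in> pi1_class \<Gamma> T u" "w' \<in> pi1_class \<Gamma> T w" for u' w'
  proof -
    have "u @ w \<in> pi1_words \<Gamma>"
      using assms by (simp add: pi1_words_def)
    moreover have "pi1_eq \<Gamma> T (u' @ w') (u @ w)"
      using that by (auto simp: pi1_class_def intro: pi1_eq.append pi1_eq.sym)
    ultimately show ?thesis
      using pi1_class_eq_iff by blast
  qed
  have "u \<in> pi1_class \<Gamma> T u" "w \<in> pi1_class \<Gamma> T w"
    using assms by (simp_all add: pi1_class_def pi1_eq.refl)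
  with eq have "(\<Union>u' \<in> pi1_class \<Gamma> T u. \<Union>w' \<in> pi1_class \<Gamma> T w. pi1_class \<Gamma> T (u' @ w')) =
      pi1_class \<Gamma> T (u @ w)"
    by blast
  then show ?thesis
    by (simp add: pi1_def)
qed

lemma pi1_letter_inverse:
  assumes "is_graph_of_groups \<Gamma>" "[a] \<in> pi1_words \<Gamma>"
  shows "\<exists>b. [b] \<in> pi1_words \<Gamma> \<and> pi1_eq \<Gamma> T [b, a] []"
proof (cases a)
  case (Vertex_Letter v g)
  then have v: "v \<in> verts (graph_of \<Gamma>)" and g: "g \<in> carrier (vertex_group \<Gamma> v)"
    using assms(2) by (auto simp: pi1_words_def)
  then interpret A: group "vertex_group \<Gamma> v"
    using assms(1) by (simp add: is_graph_of_groups_def)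
  let ?b = "Vertex_Letter v (inv\<^bsub>vertex_group \<Gamma> v\<^esub> g)"
  have "pi1_eq \<Gamma> T [?b, a] []"
    using pi1_eq.vertex_mult[OF v A.inv_closed[OF g] g, of T] pi1_eq.vertex_one[OF v, of T]
    by (simp add: Vertex_Letter g pi1_eq.trans)
  moreover have "[?b] \<in> pi1_words \<Gamma>"
    using v g by (auto simp: pi1_words_def)
  ultimately show ?thesis by blast
next
  case (Arc_Letter e)
  then have e: "e \<in> arcs (graph_of \<Gamma>)"
    using assms(2) by (auto simp: pi1_words_def)
  interpret B: bidirected_digraph "graph_of \<Gamma>" "reversal \<Gamma>"
    using assms(1) by (simp add: is_graph_of_groups_def)
  have "pi1_eq \<Gamma> T [Arc_Letter (reversal \<Gamma> e), a] []"
    using pi1_eq.reversal[of "reversal \<Gamma> e" \<Gamma> T] e by (simp add: Arc_Letter)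
  moreover have "[Arc_Letter (reversal \<Gamma> e)] \<in> pi1_words \<Gamma>"
    using e by (auto simp: pi1_words_def)
  ultimately show ?thesis by blast
qed

lemma pi1_word_inverse:
  assumes "is_graph_of_groups \<Gamma>" "u \<in> pi1_words \<Gamma>"
  shows "\<exists>w \<in> pi1_words \<Gamma>. pi1_eq \<Gamma> T (w @ u) []"
  using assms(2)
proof (induction u)
  case Nil
  then show ?case by (intro bexI[of _ "[]"]) (auto simp: pi1_words_def intro: pi1_eq.refl)
next
  case (Cons a u)
  then have a: "[a] \<in> pi1_words \<Gamma>" and u: "u \<in> pi1_words \<Gamma>"
    by (auto simp: pi1_words_def)
  obtain w where w: "w \<in> pi1_words \<Gamma>" "pi1_eq \<Gamma> T (w @ u) []"
    using Cons.IH[OF u] by blast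
  obtain b where b: "[b] \<in> pi1_words \<Gamma>" "pi1_eq \<Gamma> T [b, a] []"
    using pi1_letter_inverse[OF assms(1) a] by blast
  have "pi1_eq \<Gamma> T (w @ [b, a] @ u) (w @ [] @ u)"
    using w(1) u b(2) by (intro pi1_eq.append pi1_eq.refl)
  then have "pi1_eq \<Gamma> T ((w @ [b]) @ a # u) []"
    using w(2) by (auto intro: pi1_eq.trans)
  moreover have "w @ [b] \<in> pi1_words \<Gamma>"
    using w(1) b(1) by (auto simp: pi1_words_def)
  ultimately show ?case by blast
qed

lemma group_pi1:
  assumes "is_graph_of_groups \<Gamma>"
  shows "group (pi1 \<Gamma> T)"
proof (rule groupI)
  have app: "u @ w \<in> pi1_words \<Gamma>" if "u \<in> pi1_words \<Gamma>" "w \<in> pi1_words \<Gamma>" for u w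
    using that by (auto simp: pi1_words_def)
  have nil: "[] \<in> pi1_words \<Gamma>"
    by (simp add: pi1_words_def)
  have car: "carrier (pi1 \<Gamma> T) = pi1_class \<Gamma> T ` pi1_words \<Gamma>"
    and one: "\<one>\<^bsub>pi1 \<Gamma> T\<^esub> = pi1_class \<Gamma> T []"
    by (simp_all add: pi1_def)
  show "x \<otimes>\<^bsub>pi1 \<Gamma> T\<^esub> y \<in> carrier (pi1 \<Gamma> T)"
    if "x \<in> carrier (pi1 \<Gamma> T)" "y \<in> carrier (pi1 \<Gamma> T)" for x y
    using that by (auto simp: car pi1_mult app)
  show "\<one>\<^bsub>pi1 \<Gamma> T\<^esub> \<in> carrier (pi1 \<Gamma> T)"
    by (simp add: car one nil)
  show "x \<otimes>\<^bsub>pi1 \<Gamma> T\<^esub> y \<otimes>\<^bsub>pi1 \<Gamma> T\<^esub> z = x \<otimes>\<^bsub>pi1 \<Gamma> T\<^esub> (y \<otimes>\<^bsub>pi1 \<Gamma> T\<^esub> z)"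
    if "x \<in> carrier (pi1 \<Gamma> T)" "y \<in> carrier (pi1 \<Gamma> T)" "z \<in> carrier (pi1 \<Gamma> T)" for x y z
    using that by (auto simp: car pi1_mult app)
  show "\<one>\<^bsub>pi1 \<Gamma> T\<^esub> \<otimes>\<^bsub>pi1 \<Gamma> T\<^esub> x = x" if "x \<in> carrier (pi1 \<Gamma> T)" for x
    using that by (auto simp: car one pi1_mult nil)
  show "\<exists>y \<in> carrier (pi1 \<Gamma> T). y \<otimes>\<^bsub>pi1 \<Gamma> T\<^esub> x = \<one>\<^bsub>pi1 \<Gamma> T\<^esub>" if "x \<in> carrier (pi1 \<Gamma> T)" for x
  proof -
    obtain u where u: "u \<in> pi1_words \<Gamma>" "x = pi1_class \<Gamma> T u"
      using \<open>x \<in> carrier (pi1 \<Gamma> T)\<close> by (auto simp: car)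
    obtain w where w: "w \<in> pi1_words \<Gamma>" "pi1_eq \<Gamma> T (w @ u) []"
      using pi1_word_inverse[OF assms u(1)] by blast
    have "pi1_class \<Gamma> T (w @ u) = pi1_class \<Gamma> T []"
      using pi1_class_eq_iff[OF nil] w(2) by metis
    then show ?thesis
      using u w(1) by (auto simp: car one pi1_mult intro!: bexI[of _ "pi1_class \<Gamma> T w"])
  qed
qed

end

theory Submission
  imports Defs
begin

text \<open>First, replace the tree by a minimal subtree whose vertex groups still generate \<open>G\<close>, so that
  for each of its edges \<open>e\<close> the group \<open>G\<close> is a nontrivial amalgam over the edge group
  \<open>C e\<close>.  Since \<open>H\<close> is finitely generated, all but finitely many cosets \<open>g H\<close>, up to left
  multiplication by \<open>C e\<close>, lie on one side of \<open>e\<close>; if there were such a coset, then \<open>H\<close>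
  itself would lie on that side together with \<open>C e\<close>, which normality excludes by conjugating across
  the edge.  So \<open>C e H\<close> has finite index, and there is a normal subgroup \<open>N\<close> of finite index
  with \<open>H \<subseteq> N \<subseteq> C e H\<close> for all edges \<open>e\<close>.

  Second, every coset \<open>x H\<close> with \<open>x \<in> N\<close> has representatives of length \<open>O(|x|)\<close> in each
  vertex group and in each edge group, and any two such representatives in one vertex group differ by an
  element of \<open>A v \<inter> H\<close> of linear length.  Passing along edges and conjugating by generators, one
  finds that \<open>y a y\<^sup>-\<^sup>1 a\<^sup>-\<^sup>1\<close>, for fixed \<open>y \<in> H\<close> and \<open>a \<in> A v \<inter> N\<close>, has
  length in \<open>H\<close> bounded by the distortion of the vertex groups.  An element of \<open>H\<close> is a product
  of \<open>n\<close> Schreier generators \<open>y\<^sub>i a\<^sub>i\<close> of \<open>N\<close> with \<open>y\<^sub>i \<in> H\<close> and \<open>a\<^sub>i \<in> A v\<close>, and moving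
  the \<open>a\<^sub>i\<close> to the right costs \<open>n\<close> conjugations of this kind.\<close>

section \<open>Balls in the word metric\<close>

abbreviation word_prod :: "('a, 'b) monoid_scheme \<Rightarrow> 'a list \<Rightarrow> 'a" where
  "word_prod G ws \<equiv> foldr (\<lambda>x y. x \<otimes>\<^bsub>G\<^esub> y) ws \<one>\<^bsub>G\<^esub>"

text \<open>Length estimates are phrased as membership in balls, which also records that the element
  is generated by \<open>S\<close>. Allowing words of length at most \<open>n\<close> makes balls
  increase with \<open>n\<close>.\<close>

definition word_ball :: "('a, 'b) monoid_scheme \<Rightarrow> 'a set \<Rightarrow> nat \<Rightarrow> 'a set" where
  "word_ball G S n = {word_prod G ws | ws. length ws \<le> n \<and> set ws \<subseteq> S \<union> m_inv G ` S}"

section \<open>Balls under products, inverses, conjugation and change of generators\<close>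

context group
begin

lemma cancel_inv_left [simp]:
  "x \<in> carrier G \<Longrightarrow> y \<in> carrier G \<Longrightarrow> inv x \<otimes> (x \<otimes> y) = y"
  "x \<in> carrier G \<Longrightarrow> y \<in> carrier G \<Longrightarrow> x \<otimes> (inv x \<otimes> y) = y"
  by (simp_all flip: m_assoc)

lemma word_prod_closed: "set ws \<subseteq> carrier G \<Longrightarrow> word_prod G ws \<in> carrier G"
  by (induction ws) auto

lemma word_prod_append:
  "set us \<subseteq> carrier G \<Longrightarrow> set vs \<subseteq> carrier G \<Longrightarrow>
    word_prod G (us @ vs) = word_prod G us \<otimes> word_prod G vs"
  by (induction us) (auto simp: m_assoc word_prod_closed)

lemma word_prod_subgroup: "subgroup P G \<Longrightarrow> set ws \<subseteq> P \<Longrightarrow> word_prod G ws \<in> P"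
  by (induction ws) (auto simp: subgroup.one_closed subgroup.m_closed)

lemma letters_carrier: "S \<subseteq> carrier G \<Longrightarrow> S \<union> m_inv G ` S \<subseteq> carrier G"
  by auto

lemma word_ball_carrier: "S \<subseteq> carrier G \<Longrightarrow> word_ball G S n \<subseteq> carrier G"
  unfolding word_ball_def using word_prod_closed[OF order_trans[OF _ letters_carrier]] by blast

lemma word_ball_mono: "m \<le> n \<Longrightarrow> word_ball G S m \<subseteq> word_ball G S n"
  unfolding word_ball_def by (blast intro: order_trans)

lemma word_ball_mono_gens: "S \<subseteq> S' \<Longrightarrow> word_ball G S n \<subseteq> word_ball G S' n"
  unfolding word_ball_def by blast

lemma one_in_word_ball: "\<one> \<in> word_ball G S n"
  unfolding word_ball_def by (auto intro: exI[of _ "[]"])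

lemma word_ball_mult:
  assumes "S \<subseteq> carrier G" "x \<in> word_ball G S m" "y \<in> word_ball G S n"
  shows "x \<otimes> y \<in> word_ball G S (m + n)"
proof -
  obtain us vs where "length us \<le> m" "set us \<subseteq> S \<union> m_inv G ` S" "x = word_prod G us"
    "length vs \<le> n" "set vs \<subseteq> S \<union> m_inv G ` S" "y = word_prod G vs"
    using assms unfolding word_ball_def by blast
  moreover from this have "word_prod G (us @ vs) = word_prod G us \<otimes> word_prod G vs"
    using letters_carrier[OF assms(1)] by (intro word_prod_append) blast+
  ultimately show ?thesis
    unfolding word_ball_def by (intro CollectI exI[of _ "us @ vs"]) (simp del: foldr_append)
qed

lemma letter_in_word_ball: "S \<subseteq> carrier G \<Longrightarrow> s \<in> S \<union> m_inv G ` S \<Longrightarrow> s \<in> word_ball G S 1"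
  unfolding word_ball_def by (intro CollectI exI[of _ "[s]"]) auto

lemma gen_in_word_ball: "S \<subseteq> carrier G \<Longrightarrow> s \<in> S \<Longrightarrow> s \<in> word_ball G S 1"
  using letter_in_word_ball by blast

lemma inv_letter: "S \<subseteq> carrier G \<Longrightarrow> s \<in> S \<union> m_inv G ` S \<Longrightarrow> inv s \<in> S \<union> m_inv G ` S"
  by auto

lemma word_ball_induct [consumes 2, case_names one mult]:
  assumes "S \<subseteq> carrier G" "x \<in> word_ball G S n"
    and one: "\<And>n. P n \<one>"
    and mult: "\<And>n s x. s \<in> S \<union> m_inv G ` S \<Longrightarrow> x \<in> word_ball G S n \<Longrightarrow> x \<in> carrier G \<Longrightarrow> P n x \<Longrightarrow>
      P (Suc n) (s \<otimes> x)"
  shows "P n x"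
proof -
  have "P n (word_prod G ws)" if "length ws \<le> n" "set ws \<subseteq> S \<union> m_inv G ` S" for ws
    using that
  proof (induction ws arbitrary: n)
    case Nil
    then show ?case using one by simp
  next
    case (Cons s ws)
    then obtain m where m: "n = Suc m" "length ws \<le> m" by (cases n) auto
    moreover have "word_prod G ws \<in> word_ball G S m"
      using Cons.prems m unfolding word_ball_def by auto
    ultimately show ?case
      using mult[of s "word_prod G ws" m] Cons word_ball_carrier[OF assms(1)] by auto
  qed
  then show ?thesis using assms(2) unfolding word_ball_def by blast
qed

lemma word_ball_inv:
  assumes "S \<subseteq> carrier G" "x \<in> word_ball G S n"
  shows "inv x \<in> word_ball G S n"
  using assms
proof (induction rule: word_ball_induct)
  case (one n)
  then show ?case by (simp add: one_in_word_ball)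
next
  case (mult n s x)
  have "s \<in> carrier G" using mult(1) letters_carrier[OF assms(1)] by blast
  moreover have "inv s \<in> word_ball G S 1"
    by (rule letter_in_word_ball[OF assms(1) inv_letter[OF assms(1) mult(1)]])
  ultimately show ?case
    using word_ball_mult[OF assms(1) mult(4), of "inv s" 1] mult(3) by (simp add: inv_mult_group)
qed

lemma word_ball_subgroup:
  assumes "subgroup P G" "S \<subseteq> P"
  shows "word_ball G S n \<subseteq> P"
proof -
  have "S \<union> m_inv G ` S \<subseteq> P" using assms subgroup.m_inv_closed[OF assms(1)] by blast
  then show ?thesis unfolding word_ball_def using word_prod_subgroup[OF assms(1)] by blast
qed

lemma generate_eq_UN_word_ball:
  assumes "S \<subseteq> carrier G"
  shows "generate G S = (\<Union>n. word_ball G S n)"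
proof
  show "(\<Union>n. word_ball G S n) \<subseteq> generate G S"
    using word_ball_subgroup[OF generate_is_subgroup[OF assms]] generate.incl[of _ S G] by blast
  show "generate G S \<subseteq> (\<Union>n. word_ball G S n)"
  proof
    fix x assume "x \<in> generate G S"
    then show "x \<in> (\<Union>n. word_ball G S n)"
    proof (induction rule: generate.induct)
      case one
      then show ?case using one_in_word_ball by blast
    next
      case (incl h)
      then show ?case using letter_in_word_ball[OF assms] by blast
    next
      case (inv h)
      then show ?case using letter_in_word_ball[OF assms] by blast
    next
      case (eng h1 h2)
      then show ?case using word_ball_mult[OF assms] by blast
    qed
  qed
qed

lemma generate_letter_induct [consumes 2, case_names one mult]:
  assumes "S \<subseteq> carrier G" "x \<in> generate G S"
    and "P \<one>"
    and "\<And>s x. s \<in> S \<union> m_inv G ` S \<Longrightarrow> x \<in> carrier G \<Longrightarrow> P x \<Longrightarrow> P (s \<otimes> x)"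
  shows "P x"
proof -
  obtain n where "x \<in> word_ball G S n"
    using assms generate_eq_UN_word_ball[OF assms(1)] by blast
  with assms(1) show ?thesis
    by (induction rule: word_ball_induct) (auto intro: assms)
qed

text \<open>Each of the finitely many elements of \<open>Z\<close> is a word in \<open>S\<close>, so
  substituting these words stretches lengths by a constant factor. Every change of generators below
  goes through this lemma.\<close>

lemma word_ball_lipschitz:
  assumes S: "S \<subseteq> carrier G" and Z: "finite Z" "Z \<subseteq> generate G S"
  shows "\<exists>K>0. \<forall>n. word_ball G Z n \<subseteq> word_ball G S (K * n)"
proof -
  have "\<exists>K. \<forall>z\<in>Z. z \<in> word_ball G S K"
    using Z
  proof (induction rule: finite_induct)
    case empty
    then show ?case by simp
  next
    case (insert z Z)
    then obtain K L where "\<forall>z\<in>Z. z \<in> word_ball G S K" "z \<in> word_ball G S L"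
      using generate_eq_UN_word_ball[OF S] by auto
    then have "\<forall>z\<in>insert z Z. z \<in> word_ball G S (K + L)"
      using word_ball_mono[of K "K + L" S] word_ball_mono[of L "K + L" S] by auto
    then show ?case by blast
  qed
  then obtain K0 where K0: "\<forall>z\<in>Z. z \<in> word_ball G S K0" by blast
  \<comment> \<open>The successor keeps the factor positive even if \<open>K0\<close> is
    zero.\<close>
  define K where "K = Suc K0"
  have K: "z \<in> word_ball G S K" if "z \<in> Z" for z
    using K0 that word_ball_mono[of K0 K S] unfolding K_def by auto
  have Zc: "Z \<subseteq> carrier G"
    using Z generate_in_carrier[OF S] by blast
  have "x \<in> word_ball G S (K * n)" if "x \<in> word_ball G Z n" for x n
    using Zc that
  proof (induction rule: word_ball_induct)
    case (one n)
    then show ?case by (simp add: one_in_word_ball)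
  next
    case (mult n s x)
    have "s \<in> word_ball G S K"
      using mult(1) K word_ball_inv[OF S] by blast
    then show ?case using word_ball_mult[OF S _ mult(4)] by auto
  qed
  then show ?thesis unfolding K_def by blast
qed

lemma word_ball_conj:
  assumes S: "S \<subseteq> carrier G" and g: "g \<in> carrier G" and x: "x \<in> word_ball G S n"
  shows "g \<otimes> x \<otimes> inv g \<in> word_ball G ((\<lambda>s. g \<otimes> s \<otimes> inv g) ` S) n"
  using S x
proof (induction rule: word_ball_induct)
  case (one n)
  then show ?case using g by (simp add: one_in_word_ball)
next
  case (mult n s x)
  let ?S = "(\<lambda>s. g \<otimes> s \<otimes> inv g) ` S"
  have S': "?S \<subseteq> carrier G" using S g by auto
  have s: "s \<in> carrier G" using mult(1) S by auto
  have "g \<otimes> s \<otimes> inv g \<in> ?S \<union> m_inv G ` ?S"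
  proof (cases "s \<in> S")
    case False
    then obtain t where t: "t \<in> S" "s = inv t" using mult(1) by blast
    then have "g \<otimes> s \<otimes> inv g = inv (g \<otimes> t \<otimes> inv g)"
      using S g by (auto simp: inv_mult_group m_assoc)
    then show ?thesis using t by blast
  qed blast
  then have "g \<otimes> s \<otimes> inv g \<in> word_ball G ?S 1"
    by (rule letter_in_word_ball[OF S'])
  then have "g \<otimes> s \<otimes> inv g \<otimes> (g \<otimes> x \<otimes> inv g) \<in> word_ball G ?S (1 + n)"
    by (rule word_ball_mult[OF S' _ mult(4)])
  then show ?case using s mult(3) g by (simp add: m_assoc)
qed

text \<open>Conjugation by a fixed \<open>g\<close> carries \<open>T\<close> to another finite
  subset of \<open>H\<close>, because \<open>H\<close> is normal; words in that subset are rewritten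
  in \<open>T\<close> at linear cost.\<close>

lemma word_ball_conj_lipschitz:
  assumes H: "H \<lhd> G" and T: "finite T" "T \<subseteq> H" "generate G T = H" and g: "g \<in> carrier G"
  shows "\<exists>K>0. \<forall>n. \<forall>x \<in> word_ball G T n. g \<otimes> x \<otimes> inv g \<in> word_ball G T (K * n)"
proof -
  have Tc: "T \<subseteq> carrier G"
    using T(2) normal_imp_subgroup[OF H] subgroup.subset by blast
  let ?T = "(\<lambda>s. g \<otimes> s \<otimes> inv g) ` T"
  have "?T \<subseteq> generate G T"
    using normal.inv_op_closed2[OF H g] T by auto
  then obtain K where "K > 0" "\<And>n. word_ball G ?T n \<subseteq> word_ball G T (K * n)"
    using word_ball_lipschitz[OF Tc, of ?T] T(1) by auto
  then show ?thesis using word_ball_conj[OF Tc g] by blast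
qed

section \<open>Finiteness of balls and the passage to word lengths\<close>

lemma finite_word_ball:
  assumes "finite S"
  shows "finite (word_ball G S n)"
proof -
  have "word_ball G S n \<subseteq> word_prod G ` {ws. set ws \<subseteq> S \<union> m_inv G ` S \<and> length ws \<le> n}"
    unfolding word_ball_def by blast
  moreover have "finite {ws. set ws \<subseteq> S \<union> m_inv G ` S \<and> length ws \<le> n}"
    using assms by (intro finite_lists_length_le) auto
  ultimately show ?thesis using finite_surj by blast
qed

lemma word_length_le: "x \<in> word_ball G S n \<Longrightarrow> word_length G S x \<le> n"
  unfolding word_length_def word_ball_def
  by (auto intro: order_trans[OF Least_le])

lemma in_word_ball_word_length:
  assumes "S \<subseteq> carrier G" "x \<in> generate G S"
  shows "x \<in> word_ball G S (word_length G S x)"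
proof -
  obtain n where "x \<in> word_ball G S n"
    using assms generate_eq_UN_word_ball[OF assms(1)] by blast
  then obtain ws where "set ws \<subseteq> S \<union> m_inv G ` S" "x = word_prod G ws"
    unfolding word_ball_def by blast
  then have "\<exists>ws'. length ws' = length ws \<and> set ws' \<subseteq> S \<union> m_inv G ` S \<and> word_prod G ws' = x"
    by blast
  from LeastI[of "\<lambda>n. \<exists>ws. length ws = n \<and> set ws \<subseteq> S \<union> m_inv G ` S \<and> word_prod G ws = x", OF this]
  show ?thesis
    unfolding word_length_def word_ball_def by (metis (mono_tags, lifting) CollectI order_refl)
qed

lemma word_length_le_iff:
  "S \<subseteq> carrier G \<Longrightarrow> x \<in> generate G S \<Longrightarrow> word_length G S x \<le> n \<longleftrightarrow> x \<in> word_ball G S n"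
  by (meson in_word_ball_word_length word_length_le word_ball_mono subsetD)

end

section \<open>Cosets and Schreier generators\<close>

context group
begin

section \<open>Equality of cosets\<close>

lemma normal_carrier: "N \<lhd> G \<Longrightarrow> x \<in> N \<Longrightarrow> x \<in> carrier G"
  by (rule subgroup.mem_carrier[OF normal_imp_subgroup])

lemma rcos_eq_iff:
  assumes K: "subgroup K G" and "a \<in> carrier G" "b \<in> carrier G"
  shows "K #> a = K #> b \<longleftrightarrow> a \<otimes> inv b \<in> K"
proof -
  have "a \<in> K #> b \<longleftrightarrow> K #> b = K #> a"
    using repr_independence[OF _ assms(3) K] rcos_self[OF assms(2) K] by metis
  then show ?thesis
    using subgroup.rcos_module[OF K is_group assms(3,2)] by auto
qed

lemmas normal_coset_eq_iff = rcos_eq_iff[OF normal_imp_subgroup]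

lemma normal_coset_eq_iff':
  assumes "N \<lhd> G" "a \<in> carrier G" "b \<in> carrier G"
  shows "N #> a = N #> b \<longleftrightarrow> inv a \<otimes> b \<in> N"
proof -
  have "a \<otimes> inv b \<in> N \<longleftrightarrow> inv a \<otimes> b \<in> N"
  proof
    assume "a \<otimes> inv b \<in> N"
    from normal.inv_op_closed1[OF assms(1) _ subgroup.m_inv_closed[OF normal_imp_subgroup[OF assms(1)] this], of a]
    show "inv a \<otimes> b \<in> N" using assms by (simp add: inv_mult_group m_assoc)
  next
    assume "inv a \<otimes> b \<in> N"
    from normal.inv_op_closed2[OF assms(1) _ subgroup.m_inv_closed[OF normal_imp_subgroup[OF assms(1)] this], of a]
    show "a \<otimes> inv b \<in> N" using assms by (simp add: inv_mult_group m_assoc)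
  qed
  then show ?thesis using normal_coset_eq_iff[OF assms] by simp
qed

lemma normal_coset_mult_cong:
  assumes "N \<lhd> G" "a \<in> carrier G" "b \<in> carrier G" "a' \<in> carrier G" "b' \<in> carrier G"
    "N #> a = N #> a'" "N #> b = N #> b'"
  shows "N #> (a \<otimes> b) = N #> (a' \<otimes> b')"
  using normal.rcos_sum[OF assms(1)] assms by metis

text \<open>Schreier's rewriting: reading a word from right to left, each letter \<open>s\<close> is
  corrected by coset representatives before and after it, which yields an element of
  \<open>N\<close> from a finite list. The number of factors does not grow.\<close>

lemma schreier:
  assumes N: "N \<lhd> G" and fin: "finite (rcosets N)" and S: "finite S" "S \<subseteq> carrier G"
  obtains Z where "finite Z" "Z \<subseteq> N"
    "\<And>n x. x \<in> N \<Longrightarrow> x \<in> word_ball G S n \<Longrightarrow>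
      \<exists>zs. length zs \<le> n \<and> set zs \<subseteq> Z \<and> x = word_prod G zs"
proof -
  note NG = normal_imp_subgroup[OF N]
  \<comment> \<open>\<open>N\<close> itself is represented by the identity, so that no correction is
    left over at the end of the rewriting for elements of \<open>N\<close>.\<close>
  define \<rho> where "\<rho> Y = (if Y = N then \<one> else (SOME y. y \<in> Y))" for Y
  define r where "r x = \<rho> (N #> x)" for x
  have r: "r x \<in> carrier G" "N #> r x = N #> x" if x: "x \<in> carrier G" for x
  proof -
    have "r x \<in> N #> x"
    proof (cases "N #> x = N")
      case True
      then show ?thesis using subgroup.one_closed[OF NG] by (simp add: r_def \<rho>_def)
    next
      case False
      then show ?thesis
        unfolding r_def \<rho>_def using rcos_self[OF x NG] by (auto intro: someI)
    qed
    then show "r x \<in> carrier G" "N #> r x = N #> x"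
      using repr_independence[OF _ x NG] subgroup.elemrcos_carrier[OF NG is_group x] by auto
  qed
  define Z where "Z = N \<inter> (\<lambda>(Y, s, Y'). inv (\<rho> Y) \<otimes> s \<otimes> \<rho> Y') `
    ((rcosets N) \<times> (S \<union> m_inv G ` S) \<times> (rcosets N))"
  have "finite Z" unfolding Z_def using fin S by auto
  moreover have "Z \<subseteq> N" unfolding Z_def by blast
  moreover have "\<exists>zs. length zs \<le> n \<and> set zs \<subseteq> Z \<and> x = word_prod G zs"
    if "x \<in> N" "x \<in> word_ball G S n" for n x
  proof -
    have "\<exists>zs. length zs \<le> n \<and> set zs \<subseteq> Z \<and> x = r x \<otimes> word_prod G zs"
      using S(2) \<open>x \<in> word_ball G S n\<close>
    proof (induction rule: word_ball_induct)
      case (one n)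
      then show ?case
        using coset_mult_one[OF subgroup.subset[OF NG]]
        by (intro exI[of _ "[]"]) (simp add: r_def \<rho>_def)
    next
      case (mult n s x)
      have s: "s \<in> carrier G" using mult(1) letters_carrier[OF S(2)] by blast
      obtain zs where zs: "length zs \<le> n" "set zs \<subseteq> Z" "x = r x \<otimes> word_prod G zs"
        using mult by blast
      \<comment> \<open>The representative \<open>r x\<close> is cancelled and
        \<open>r (s \<otimes> x)\<close> created, so the correction telescopes. Since
        \<open>z\<close> depends only on two cosets and a letter, it lies in the finite set
        \<open>Z\<close>.\<close>
      define z where "z = inv (r (s \<otimes> x)) \<otimes> s \<otimes> r x"
      have zsc: "set zs \<subseteq> carrier G" using zs(2) \<open>Z \<subseteq> N\<close> subgroup.subset[OF NG] by blast
      have "N #> (s \<otimes> r x) = N #> (s \<otimes> x)"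
        using s mult(3) r[OF mult(3)] by (intro normal_coset_mult_cong[OF N]) auto
      then have "N #> r (s \<otimes> x) = N #> (s \<otimes> r x)"
        using r(2)[of "s \<otimes> x"] s mult(3) by simp
      then have "z \<in> N"
        using normal_coset_eq_iff'[OF N, of "r (s \<otimes> x)" "s \<otimes> r x"] r(1) s mult(3)
        by (simp add: z_def m_assoc)
      then have "z \<in> Z"
        unfolding Z_def z_def r_def using mult(1) rcosetsI[OF subgroup.subset[OF NG]] s mult(3)
        by (auto intro!: image_eqI[where x = "(N #> (s \<otimes> x), s, N #> x)"])
      moreover have "s \<otimes> x = r (s \<otimes> x) \<otimes> word_prod G (z # zs)"
      proof -
        have "r (s \<otimes> x) \<otimes> word_prod G (z # zs) = s \<otimes> (r x \<otimes> word_prod G zs)"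
          using r(1)[of "s \<otimes> x"] r(1)[OF mult(3)] s mult(3) word_prod_closed[OF zsc]
          by (simp add: z_def m_assoc)
        then show ?thesis using zs(3) by simp
      qed
      ultimately show ?case using zs by (intro exI[of _ "z # zs"]) auto
    qed
    moreover have "r x = \<one>"
      using that(1) coset_join2[OF _ NG that(1)] subgroup.subset[OF NG]
      by (auto simp: r_def \<rho>_def)
    moreover have "word_prod G zs \<in> carrier G" if "set zs \<subseteq> Z" for zs
      using that \<open>Z \<subseteq> N\<close> subgroup.subset[OF NG] by (intro word_prod_closed) blast
    ultimately show ?thesis by force
  qed
  ultimately show thesis using that by blast
qed

lemma normal_coset_lift:
  assumes H: "H \<lhd> G" and P: "subgroup P G" and x: "x \<in> P <#> H"
  shows "\<exists>p\<in>P. H #> p = H #> x"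
proof -
  obtain p h where ph: "p \<in> P" "h \<in> H" "x = p \<otimes> h" using x unfolding set_mult_def by blast
  then have "p \<in> carrier G" "h \<in> carrier G"
    by (auto intro: subgroup.mem_carrier[OF P] normal_carrier[OF H])
  then have "H #> p = H #> x"
    using ph normal_coset_eq_iff'[OF H, of p x] by simp
  with ph(1) show ?thesis by blast
qed

text \<open>Each Schreier generator of \<open>N\<close> is replaced by an element of
  \<open>P\<close> in the same coset of \<open>H\<close>. Normality of \<open>H\<close> makes the
  replacement compatible with products, so a lift needs at most as many factors as the original word
  has letters.\<close>

lemma coset_lift:
  assumes H: "H \<lhd> G" and N: "N \<lhd> G" and fin: "finite (rcosets N)"
    and S: "finite S" "S \<subseteq> carrier G" and P: "subgroup P G" "N \<subseteq> P <#> H"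
  obtains Y where "finite Y" "Y \<subseteq> P"
    "\<And>n x. x \<in> N \<Longrightarrow> x \<in> word_ball G S n \<Longrightarrow> \<exists>y \<in> word_ball G Y n. H #> y = H #> x"
proof -
  obtain Z where Z: "finite Z" "Z \<subseteq> N"
    "\<And>n x. x \<in> N \<Longrightarrow> x \<in> word_ball G S n \<Longrightarrow>
      \<exists>zs. length zs \<le> n \<and> set zs \<subseteq> Z \<and> x = word_prod G zs"
    using schreier[OF N fin S] by blast
  have "\<forall>z\<in>Z. \<exists>p\<in>P. H #> p = H #> z"
    using normal_coset_lift[OF H P(1)] P(2) Z(2) by blast
  then obtain p where p: "\<And>z. z \<in> Z \<Longrightarrow> p z \<in> P \<and> H #> p z = H #> z" by metis
  have Pc: "P \<subseteq> carrier G" using P(1) subgroup.subset by blast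
  have Zc: "Z \<subseteq> carrier G" using Z(2) normal_carrier[OF N] by blast
  have pc: "p z \<in> carrier G" if "z \<in> Z" for z using p[OF that] Pc by blast
  have eq: "H #> word_prod G (map p zs) = H #> word_prod G zs" if "set zs \<subseteq> Z" for zs
    using that
  proof (induction zs)
    case (Cons z zs)
    have "H #> (p z \<otimes> word_prod G (map p zs)) = H #> (z \<otimes> word_prod G zs)"
      using Cons p pc Zc by (intro normal_coset_mult_cong[OF H] word_prod_closed) auto
    then show ?case by simp
  qed simp
  show thesis
  proof (rule that[of "p ` Z"])
    show "finite (p ` Z)" "p ` Z \<subseteq> P" using Z(1) p by auto
    fix n x assume "x \<in> N" "x \<in> word_ball G S n"
    then obtain zs where zs: "length zs \<le> n" "set zs \<subseteq> Z" "x = word_prod G zs"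
      using Z(3) by blast
    then have "word_prod G (map p zs) \<in> word_ball G (p ` Z) n"
      unfolding word_ball_def by (intro CollectI exI[of _ "map p zs"]) auto
    then show "\<exists>y \<in> word_ball G (p ` Z) n. H #> y = H #> x"
      using eq[OF zs(2)] zs(3) by blast
  qed
qed

end

section \<open>Comparing lifts to the vertex groups\<close>

text \<open>What the distortion estimate retains of a tree of groups: \<open>E\<close> is adjacency
  of vertices, \<open>A u \<inter> A v\<close> takes the place of the edge group, and
  \<open>F\<close> bounds the distortion of every \<open>A v \<inter> H\<close>, measured in
  \<open>T\<close>. The vertex condition on \<open>N\<close> is stated apart from the edge condition
  because \<open>X\<close> may be a single vertex.\<close>

locale commensurable_vertex_groups = group G for G (structure) +
  fixes H N T :: "'a set" and X :: "'v set" and A S :: "'v \<Rightarrow> 'a set" and E :: "('v \<times> 'v) set"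
    and F :: "nat \<Rightarrow> nat"
  assumes H: "H \<lhd> G" and N: "N \<lhd> G" and H_le_N: "H \<subseteq> N" and finite_index: "finite (rcosets N)"
    and T: "finite T" "T \<subseteq> H" "generate G T = H"
    and X: "finite X" "X \<noteq> {}"
    and A: "v \<in> X \<Longrightarrow> subgroup (A v) G"
    and S: "v \<in> X \<Longrightarrow> finite (S v)" "v \<in> X \<Longrightarrow> S v \<subseteq> A v"
      "v \<in> X \<Longrightarrow> generate G (S v) = A v"
    and generates: "generate G (\<Union>v\<in>X. S v) = carrier G"
    and N_le_A: "v \<in> X \<Longrightarrow> N \<subseteq> A v <#> H"
    and E: "(u, v) \<in> E \<Longrightarrow> u \<in> X" "(u, v) \<in> E \<Longrightarrow> v \<in> X"
      "(u, v) \<in> E \<Longrightarrow> N \<subseteq> (A u \<inter> A v) <#> H"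
    and connected: "u \<in> X \<Longrightarrow> v \<in> X \<Longrightarrow> (u, v) \<in> E\<^sup>*"
    and F_mono: "mono F"
    and F: "v \<in> X \<Longrightarrow> A v \<inter> H \<inter> word_ball G (S v) n \<subseteq> word_ball G T (F n)"
begin

abbreviation \<Sigma> :: "'a set" where "\<Sigma> \<equiv> (\<Union>v\<in>X. S v)"

section \<open>Short coset representatives in vertex and edge groups\<close>

lemma S_carrier: "v \<in> X \<Longrightarrow> S v \<subseteq> carrier G"
  using S(2) subgroup.subset[OF A] by blast

lemma \<Sigma>: "finite \<Sigma>" "\<Sigma> \<subseteq> carrier G"
  using X S(1) S_carrier by auto

lemma T_carrier: "T \<subseteq> carrier G"
  using T(2) normal_carrier[OF H] by blast

lemma H_subgroup: "subgroup H G" and N_subgroup: "subgroup N G"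
  using H N by (simp_all add: normal_imp_subgroup)

lemma A_carrier: "v \<in> X \<Longrightarrow> x \<in> A v \<Longrightarrow> x \<in> carrier G"
  using subgroup.mem_carrier[OF A] .

lemma ball_S_A: "v \<in> X \<Longrightarrow> word_ball G (S v) n \<subseteq> A v"
  using word_ball_subgroup[OF A S(2)] .

lemma ball_S_\<Sigma>: "v \<in> X \<Longrightarrow> word_ball G (S v) n \<subseteq> word_ball G \<Sigma> n"
  by (rule word_ball_mono_gens) blast

lemma H_coset_N:
  assumes "x \<in> N" "y \<in> carrier G" "H #> y = H #> x"
  shows "y \<in> N"
proof -
  have x: "x \<in> carrier G" using assms(1) normal_carrier[OF N] by blast
  have "y \<otimes> inv x \<in> N" using normal_coset_eq_iff[OF H assms(2) x] assms(3) H_le_N by blast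
  then have "y \<otimes> inv x \<otimes> x \<in> N" using subgroup.m_closed[OF N_subgroup _ assms(1)] by blast
  then show ?thesis using x assms(2) by (simp add: m_assoc)
qed

lemma vertex_lift:
  assumes v: "v \<in> X"
  obtains K where "K > 0"
    "\<And>n x. x \<in> N \<Longrightarrow> x \<in> word_ball G \<Sigma> n \<Longrightarrow> \<exists>y \<in> word_ball G (S v) (K * n). H #> y = H #> x"
proof -
  obtain Y where Y: "finite Y" "Y \<subseteq> A v"
    "\<And>n x. x \<in> N \<Longrightarrow> x \<in> word_ball G \<Sigma> n \<Longrightarrow> \<exists>y \<in> word_ball G Y n. H #> y = H #> x"
    using coset_lift[OF H N finite_index \<Sigma> A[OF v] N_le_A[OF v]] by blast
  obtain K where K: "K > 0" "\<And>n. word_ball G Y n \<subseteq> word_ball G (S v) (K * n)"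
    using word_ball_lipschitz[OF S_carrier[OF v] Y(1)] Y(2) S(3)[OF v] by blast
  show thesis by (rule that[OF K(1)]) (use Y(3) K(2) in blast)
qed

text \<open>The lifts are words in one finite subset of \<open>A u \<inter> A v\<close>, whose
  elements can be expressed both in \<open>S u\<close> and in \<open>S v\<close>. One representative
  is therefore short in both vertex groups at once.\<close>

lemma edge_lift:
  assumes uv: "(u, v) \<in> E"
  obtains K where "K > 0"
    "\<And>n x. x \<in> N \<Longrightarrow> x \<in> word_ball G \<Sigma> n \<Longrightarrow>
      \<exists>y \<in> word_ball G (S u) (K * n) \<inter> word_ball G (S v) (K * n). H #> y = H #> x"
proof -
  note u = E(1)[OF uv] and v = E(2)[OF uv]
  obtain Y where Y: "finite Y" "Y \<subseteq> A u \<inter> A v"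
    "\<And>n x. x \<in> N \<Longrightarrow> x \<in> word_ball G \<Sigma> n \<Longrightarrow> \<exists>y \<in> word_ball G Y n. H #> y = H #> x"
    using coset_lift[OF H N finite_index \<Sigma> subgroups_Inter_pair[OF A[OF u] A[OF v]] E(3)[OF uv]] by blast
  obtain K where K: "K > 0" "\<And>n. word_ball G Y n \<subseteq> word_ball G (S u) (K * n)"
    using word_ball_lipschitz[OF S_carrier[OF u] Y(1)] Y(2) S(3)[OF u] by blast
  obtain L where L: "L > 0" "\<And>n. word_ball G Y n \<subseteq> word_ball G (S v) (L * n)"
    using word_ball_lipschitz[OF S_carrier[OF v] Y(1)] Y(2) S(3)[OF v] by blast
  have "word_ball G Y n \<subseteq> word_ball G (S u) ((K + L) * n) \<inter> word_ball G (S v) ((K + L) * n)" for n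
    using K(2)[of n] L(2)[of n] word_ball_mono[of "K * n" "(K + L) * n" "S u"]
      word_ball_mono[of "L * n" "(K + L) * n" "S v"] by (simp add: add_mult_distrib) blast
  then show thesis using Y(3) K(1) by (intro that[of "K + L"]) blast+
qed

text \<open>A one-parameter family standing for all functions equivalent to \<open>F\<close> up to
  constants inside, outside and added. It is stable, after enlarging \<open>K\<close>, under sums,
  multiples and rescaling of \<open>n\<close>, as the next lemmas show.\<close>

definition bound :: "nat \<Rightarrow> nat \<Rightarrow> nat" where
  "bound K n = K * F (K * n) + K"

lemma F_le: "m \<le> n \<Longrightarrow> F m \<le> F n"
  using F_mono by (simp add: mono_def)

lemma bound_mono: "K \<le> L \<Longrightarrow> m \<le> n \<Longrightarrow> bound K m \<le> bound L n"
  unfolding bound_def by (intro add_mono mult_mono F_le) auto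

lemma bound_scale: "bound K (L * n) \<le> bound (K * Suc L) n"
proof -
  \<comment> \<open>The successor makes the outer factor at least \<open>K\<close>, also when
    \<open>L\<close> is zero.\<close>
  have "K * F (K * (L * n)) \<le> K * Suc L * F (K * Suc L * n)"
    by (rule mult_mono[OF _ F_le]) (simp_all add: algebra_simps)
  then show ?thesis unfolding bound_def by simp
qed

lemma bound_add: "bound K n + bound L n \<le> bound (K + L) n"
proof -
  have "K * F (K * n) \<le> K * F ((K + L) * n)" "L * F (L * n) \<le> L * F ((K + L) * n)"
    by (intro mult_left_mono F_le; simp)+
  from add_mono[OF this] show ?thesis unfolding bound_def by (simp add: add_mult_distrib)
qed

lemma bound_mult: "M * bound K n \<le> bound (M * K) n"
proof (cases "M = 0")
  case False
  then have "M * (K * F (K * n)) \<le> M * (K * F (M * K * n))"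
    by (intro mult_left_mono F_le) auto
  then show ?thesis unfolding bound_def by (simp add: add_mult_distrib2 mult.assoc)
qed simp

lemma F_le_bound: "F (K * n) \<le> bound (Suc K) n"
  using F_le[of "K * n" "Suc K * n"] unfolding bound_def by simp

text \<open>For \<open>y \<in> H\<close> and \<open>b = a\<close> this bounds commutators, which is all that is needed in the end;
  the two vertices and the arbitrary \<open>y\<close> make it provable by induction on \<open>y\<close>.\<close>

definition transport_bounded :: "'a \<Rightarrow> 'v \<Rightarrow> 'v \<Rightarrow> nat \<Rightarrow> bool" where
  "transport_bounded y u v K \<longleftrightarrow> (\<forall>n>0. \<forall>a \<in> N \<inter> word_ball G (S u) n. \<forall>b \<in> word_ball G (S v) n.
     y \<otimes> a \<otimes> inv y \<otimes> inv b \<in> H \<longrightarrow> y \<otimes> a \<otimes> inv y \<otimes> inv b \<in> word_ball G T (bound K n))"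

lemma transport_boundedI:
  assumes "\<And>n a b. n > 0 \<Longrightarrow> a \<in> N \<Longrightarrow> a \<in> word_ball G (S u) n \<Longrightarrow> b \<in> word_ball G (S v) n \<Longrightarrow>
     y \<otimes> a \<otimes> inv y \<otimes> inv b \<in> H \<Longrightarrow> y \<otimes> a \<otimes> inv y \<otimes> inv b \<in> word_ball G T (bound K n)"
  shows "transport_bounded y u v K"
  using assms unfolding transport_bounded_def by blast

lemma transport_boundedD:
  assumes "transport_bounded y u v K" "n > 0" "a \<in> N" "a \<in> word_ball G (S u) n"
    "b \<in> word_ball G (S v) n" "y \<otimes> a \<otimes> inv y \<otimes> inv b \<in> H"
  shows "y \<otimes> a \<otimes> inv y \<otimes> inv b \<in> word_ball G T (bound K n)"
  using assms unfolding transport_bounded_def by blast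

section \<open>Comparison of coset representatives in different vertex groups\<close>

lemma same_vertex:
  assumes v: "v \<in> X" and a: "a \<in> word_ball G (S v) m" "b \<in> word_ball G (S v) n" "a \<otimes> inv b \<in> H"
  shows "a \<otimes> inv b \<in> word_ball G T (F (m + n))"
proof -
  have "a \<otimes> inv b \<in> word_ball G (S v) (m + n)"
    using word_ball_mult[OF S_carrier[OF v] a(1) word_ball_inv[OF S_carrier[OF v] a(2)]] .
  then show ?thesis using F[OF v] ball_S_A[OF v] a(3) by blast
qed

text \<open>Induction along a path from \<open>u\<close> to \<open>v\<close>. Crossing an edge means
  inserting a representative of the same coset that lies in both adjacent vertex groups, so each new
  comparison takes place inside a single vertex group.\<close>

lemma transport_one:
  assumes u: "u \<in> X" and v: "v \<in> X"
  shows "\<exists>K>0. transport_bounded \<one> u v K"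
  using connected[OF u v]
proof (induction rule: rtrancl_induct)
  case base
  have "transport_bounded \<one> u u 3"
  proof (rule transport_boundedI)
    fix n a b
    assume n: "n > 0" and a: "a \<in> word_ball G (S u) n" "b \<in> word_ball G (S u) n"
      and h: "\<one> \<otimes> a \<otimes> inv \<one> \<otimes> inv b \<in> H"
    have "a \<in> carrier G" using a(1) ball_S_A[OF u] A_carrier[OF u] by blast
    then have "\<one> \<otimes> a \<otimes> inv \<one> \<otimes> inv b = a \<otimes> inv b" by simp
    moreover have "F (n + n) \<le> bound 3 n" using F_le_bound[of 2 n] by (simp add: mult_2)
    ultimately show "\<one> \<otimes> a \<otimes> inv \<one> \<otimes> inv b \<in> word_ball G T (bound 3 n)"
      using same_vertex[OF u a] h word_ball_mono[of "F (n + n)" "bound 3 n" T] by auto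
  qed
  then show ?case by (intro exI[of _ 3]) simp
next
  case (step v w)
  note v = E(1)[OF step(2)] and w = E(2)[OF step(2)]
  obtain K where K: "K > 0" "transport_bounded \<one> u v K" using step(3) by blast
  obtain L where L: "L > 0" "\<And>n x. x \<in> N \<Longrightarrow> x \<in> word_ball G \<Sigma> n \<Longrightarrow>
      \<exists>y \<in> word_ball G (S v) (L * n) \<inter> word_ball G (S w) (L * n). H #> y = H #> x"
    using edge_lift[OF step(2)] by blast
  have "transport_bounded \<one> u w (K * Suc L + Suc (Suc L))"
  proof (rule transport_boundedI)
    fix n a b
    assume n: "n > 0" and aN: "a \<in> N" and a: "a \<in> word_ball G (S u) n" and b: "b \<in> word_ball G (S w) n"
      and h: "\<one> \<otimes> a \<otimes> inv \<one> \<otimes> inv b \<in> H"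
    have ac: "a \<in> carrier G" using aN normal_carrier[OF N] by blast
    have bc: "b \<in> carrier G" using b ball_S_A[OF w] A_carrier[OF w] by blast
    \<comment> \<open>The element \<open>c\<close> splits the difference as
      \<open>(a \<otimes> inv c) \<otimes> (c \<otimes> inv b)\<close>: the first factor is covered
      by the induction hypothesis, the second lies in \<open>A w \<inter> H\<close>.\<close>
    obtain c where c: "c \<in> word_ball G (S v) (L * n)" "c \<in> word_ball G (S w) (L * n)"
      "H #> c = H #> a"
      using L(2)[OF aN subsetD[OF ball_S_\<Sigma>[OF u] a]] by blast
    have cc: "c \<in> carrier G" using c(1) ball_S_A[OF v] A_carrier[OF v] by blast
    have ab: "\<one> \<otimes> a \<otimes> inv \<one> \<otimes> inv x = a \<otimes> inv x" for x using ac by simp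
    have 1: "a \<otimes> inv c \<in> H" using normal_coset_eq_iff[OF H ac cc] c(3) by simp
    have "H #> c = H #> b" using h[unfolded ab] normal_coset_eq_iff[OF H ac bc] c(3) by simp
    then have 2: "c \<otimes> inv b \<in> H" using normal_coset_eq_iff[OF H cc bc] by simp
    have "n \<le> L * n" using L(1) by simp
    then have "a \<otimes> inv c \<in> word_ball G T (bound K (L * n))"
      using transport_boundedD[OF K(2), of "L * n" a c] aN a c(1) word_ball_mono[of n "L * n" "S u"]
        1 n L(1) unfolding ab by auto
    then have *: "a \<otimes> inv c \<in> word_ball G T (bound (K * Suc L) n)"
      using word_ball_mono[OF bound_scale] by blast
    have "c \<otimes> inv b \<in> word_ball G T (F (L * n + n))"
      by (rule same_vertex[OF w c(2) b 2])
    moreover have "F (L * n + n) \<le> bound (Suc (Suc L)) n"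
      using F_le_bound[of "Suc L" n] by (simp add: add.commute)
    ultimately have "c \<otimes> inv b \<in> word_ball G T (bound (Suc (Suc L)) n)"
      using word_ball_mono[of "F (L * n + n)" "bound (Suc (Suc L)) n" T] by blast
    from word_ball_mult[OF T_carrier * this]
    have "a \<otimes> inv b \<in> word_ball G T (bound (K * Suc L) n + bound (Suc (Suc L)) n)"
      using ac bc cc by (simp add: m_assoc)
    then show "\<one> \<otimes> a \<otimes> inv \<one> \<otimes> inv b \<in> word_ball G T (bound (K * Suc L + Suc (Suc L)) n)"
      unfolding ab using word_ball_mono[OF bound_add] by blast
  qed
  then show ?case using K(1) by (intro exI[of _ "K * Suc L + Suc (Suc L)"]) simp
qed

text \<open>Replace \<open>y \<otimes> a \<otimes> inv y\<close> by a representative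
  \<open>c\<close> of its coset in \<open>A w\<close>, the vertex group of the letter
  \<open>s\<close>. Conjugation by \<open>s\<close> then stays in \<open>A w\<close>, where it
  changes lengths by at most two, and \<open>transport_bounded \<one> w v L\<close> leads on to
  \<open>v\<close>. The error made by choosing \<open>c\<close> is an element of \<open>H\<close>,
  which conjugation by \<open>s\<close> stretches by the constant \<open>R\<close>.\<close>

lemma transport_step:
  assumes y: "y \<in> carrier G" and u: "u \<in> X" and v: "v \<in> X" and w: "w \<in> X"
    and s: "s \<in> S w \<union> m_inv G ` S w"
    and K: "transport_bounded y u w K" "K > 0" and L: "transport_bounded \<one> w v L"
  shows "\<exists>K>0. transport_bounded (s \<otimes> y) u v K"
proof -
  have sc: "s \<in> carrier G" using s letters_carrier[OF S_carrier[OF w]] by blast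
  obtain k where k: "y \<in> word_ball G \<Sigma> k"
    using generate_eq_UN_word_ball[OF \<Sigma>(2)] generates y by auto
  obtain M where M: "M > 0" "\<And>n x. x \<in> N \<Longrightarrow> x \<in> word_ball G \<Sigma> n \<Longrightarrow>
      \<exists>y \<in> word_ball G (S w) (M * n). H #> y = H #> x"
    using vertex_lift[OF w] by blast
  obtain R where R: "R > 0" "\<And>n x. x \<in> word_ball G T n \<Longrightarrow> s \<otimes> x \<otimes> inv s \<in> word_ball G T (R * n)"
    using word_ball_conj_lipschitz[OF H T sc] by blast
  define D where "D = M * (2 * k + 1)"
  have D: "D > 0" using M(1) by (simp add: D_def)
  have "transport_bounded (s \<otimes> y) u v (R * (K * Suc D) + L * Suc (D + 2))"
  proof (rule transport_boundedI)
    fix n a b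
    assume n: "n > 0" and aN: "a \<in> N" and a: "a \<in> word_ball G (S u) n" and b: "b \<in> word_ball G (S v) n"
      and h: "s \<otimes> y \<otimes> a \<otimes> inv (s \<otimes> y) \<otimes> inv b \<in> H"
    have ac: "a \<in> carrier G" using aN normal_carrier[OF N] by blast
    have bc: "b \<in> carrier G" using b ball_S_A[OF v] A_carrier[OF v] by blast
    define x where "x = y \<otimes> a \<otimes> inv y"
    have xN: "x \<in> N" unfolding x_def by (rule normal.inv_op_closed2[OF N y aN])
    have xc: "x \<in> carrier G" using xN normal_carrier[OF N] by blast
    have "x \<in> word_ball G \<Sigma> (k + n + k)"
      unfolding x_def using ball_S_\<Sigma>[OF u] a
      by (intro word_ball_mult[OF \<Sigma>(2)] k word_ball_inv[OF \<Sigma>(2)]) blast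
    \<comment> \<open>Here \<open>n > 0\<close> absorbs the fixed length \<open>k\<close> of
      \<open>y\<close> into a multiple of \<open>n\<close>.\<close>
    moreover have "k + n + k \<le> (2 * k + 1) * n" using n by (cases n) auto
    ultimately have "x \<in> word_ball G \<Sigma> ((2 * k + 1) * n)" using word_ball_mono by blast
    then obtain c where c: "c \<in> word_ball G (S w) (D * n)" "H #> c = H #> x"
      using M(2)[OF xN] unfolding D_def mult.assoc by blast
    have cc: "c \<in> carrier G" using c(1) ball_S_A[OF w] A_carrier[OF w] by blast
    have cN: "c \<in> N" by (rule H_coset_N[OF xN cc c(2)])
    have "n \<le> D * n" using D by simp
    then have "x \<otimes> inv c \<in> word_ball G T (bound K (D * n))"
      using transport_boundedD[OF K(1) _ aN _ c(1)] word_ball_mono[of n "D * n" "S u"] a n D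
        normal_coset_eq_iff[OF H xc cc] c(2) unfolding x_def by auto
    then have "x \<otimes> inv c \<in> word_ball G T (bound (K * Suc D) n)"
      using word_ball_mono[OF bound_scale] by blast
    then have 1: "s \<otimes> (x \<otimes> inv c) \<otimes> inv s \<in> word_ball G T (bound (R * (K * Suc D)) n)"
      using R(2) word_ball_mono[OF bound_mult] by blast
    define d where "d = s \<otimes> c \<otimes> inv s"
    have dc: "d \<in> carrier G" using sc cc by (simp add: d_def)
    have dN: "d \<in> N" unfolding d_def by (rule normal.inv_op_closed2[OF N sc cN])
    have "s \<in> word_ball G (S w) 1" by (rule letter_in_word_ball[OF S_carrier[OF w] s])
    then have "d \<in> word_ball G (S w) (1 + D * n + 1)"
      unfolding d_def by (intro word_ball_mult[OF S_carrier[OF w]] c(1) word_ball_inv[OF S_carrier[OF w]])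
    moreover have "1 + D * n + 1 \<le> (D + 2) * n" using n by (simp add: add_mult_distrib)
    ultimately have d: "d \<in> word_ball G (S w) ((D + 2) * n)" using word_ball_mono by blast
    have eq: "s \<otimes> y \<otimes> a \<otimes> inv (s \<otimes> y) = s \<otimes> x \<otimes> inv s"
      using sc y ac by (simp add: x_def m_assoc inv_mult_group)
    have "H #> d = H #> (s \<otimes> x \<otimes> inv s)"
      unfolding d_def using c(2) sc xc cc by (intro normal_coset_mult_cong[OF H]) auto
    also have "\<dots> = H #> b"
      using h normal_coset_eq_iff[OF H _ bc, of "s \<otimes> x \<otimes> inv s"] sc xc unfolding eq by simp
    finally have "d \<otimes> inv b \<in> H" using normal_coset_eq_iff[OF H dc bc] by simp
    then have "\<one> \<otimes> d \<otimes> inv \<one> \<otimes> inv b \<in> H" using dc by simp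
    moreover have "n \<le> (D + 2) * n" by simp
    ultimately have "\<one> \<otimes> d \<otimes> inv \<one> \<otimes> inv b \<in> word_ball G T (bound L ((D + 2) * n))"
      using transport_boundedD[OF L _ dN d] b word_ball_mono[of n "(D + 2) * n" "S v"] n by auto
    then have 2: "d \<otimes> inv b \<in> word_ball G T (bound (L * Suc (D + 2)) n)"
      using word_ball_mono[OF bound_scale] dc by (simp only: inv_one l_one r_one) blast
    \<comment> \<open>The conjugated choice error and the comparison of \<open>d\<close> with
      \<open>b\<close> multiply to the element in question.\<close>
    have "s \<otimes> (x \<otimes> inv c) \<otimes> inv s \<otimes> (d \<otimes> inv b) = s \<otimes> y \<otimes> a \<otimes> inv (s \<otimes> y) \<otimes> inv b"
      unfolding eq d_def using sc xc cc bc by (simp add: m_assoc)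
    then show "s \<otimes> y \<otimes> a \<otimes> inv (s \<otimes> y) \<otimes> inv b \<in>
        word_ball G T (bound (R * (K * Suc D) + L * Suc (D + 2)) n)"
      using word_ball_mult[OF T_carrier 1 2] word_ball_mono[OF bound_add] by (metis subsetD)
  qed
  then show ?thesis using R(1) K(2) by (intro exI conjI) auto
qed

lemma transport:
  assumes "y \<in> carrier G" "u \<in> X" "v \<in> X"
  shows "\<exists>K>0. transport_bounded y u v K"
proof -
  have "y \<in> generate G \<Sigma>" using assms(1) generates by simp
  \<comment> \<open>The target vertex is quantified inside the induction, because the hypothesis is
    used at the vertex \<open>w\<close> of the next letter instead of \<open>v\<close>.\<close>
  with \<Sigma>(2) have "\<forall>v\<in>X. \<exists>K>0. transport_bounded y u v K"
  proof (induction rule: generate_letter_induct)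
    case one
    then show ?case using transport_one assms(2) by blast
  next
    case (mult s y)
    then obtain w where w: "w \<in> X" "s \<in> S w \<union> m_inv G ` S w" by blast
    obtain K where K: "transport_bounded y u w K" "K > 0" using mult(3) w(1) by blast
    show ?case
    proof
      fix v assume v: "v \<in> X"
      obtain L where "transport_bounded \<one> w v L" using transport_one[OF w(1) v] by blast
      then show "\<exists>K>0. transport_bounded (s \<otimes> y) u v K"
        by (rule transport_step[OF mult(2) assms(2) v w K])
    qed
  qed
  then show ?thesis using assms(3) by blast
qed

text \<open>With \<open>u = v\<close> and \<open>b = a\<close>, \<open>transport\<close> bounds the
  commutator of \<open>y\<close> and \<open>a\<close>. Its inverse times \<open>y\<close> is the
  conjugate, at the extra cost of the fixed length of \<open>y\<close>.\<close>

lemma conj_bounded: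
  assumes y: "y \<in> H" and v: "v \<in> X"
  shows "\<exists>K>0. \<forall>n>0. \<forall>a \<in> N \<inter> word_ball G (S v) n. a \<otimes> y \<otimes> inv a \<in> word_ball G T (bound K n)"
proof -
  have yc: "y \<in> carrier G" using y normal_carrier[OF H] by blast
  obtain K where K: "K > 0" "transport_bounded y v v K" using transport[OF yc v v] by blast
  obtain k where k: "y \<in> word_ball G T k"
    using y generate_eq_UN_word_ball[OF T_carrier] T(3) by auto
  have "a \<otimes> y \<otimes> inv a \<in> word_ball G T (bound (K + k) n)"
    if n: "n > 0" and aN: "a \<in> N" and a: "a \<in> word_ball G (S v) n" for n a
  proof -
    have ac: "a \<in> carrier G" using aN normal_carrier[OF N] by blast
    have "y \<otimes> (a \<otimes> inv y \<otimes> inv a) \<in> H"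
      by (intro subgroup.m_closed[OF H_subgroup] y normal.inv_op_closed2[OF H ac]
        subgroup.m_inv_closed[OF H_subgroup])
    then have "y \<otimes> a \<otimes> inv y \<otimes> inv a \<in> H" using ac yc by (simp add: m_assoc)
    then have "inv (y \<otimes> a \<otimes> inv y \<otimes> inv a) \<in> word_ball G T (bound K n)"
      by (intro word_ball_inv[OF T_carrier] transport_boundedD[OF K(2) n aN a a])
    from word_ball_mult[OF T_carrier this k]
    have "a \<otimes> y \<otimes> inv a \<in> word_ball G T (bound K n + k)"
      using ac yc by (simp add: m_assoc inv_mult_group)
    moreover have "bound K n + k \<le> bound (K + k) n"
      using bound_add[of K n k] by (simp add: bound_def)
    ultimately show ?thesis using word_ball_mono by blast
  qed
  then show ?thesis using K(1) by (intro exI[of _ "K + k"]) auto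
qed

lemma conj_bounded_finite:
  assumes "finite Y" "Y \<subseteq> H" and v: "v \<in> X"
  shows "\<exists>K>0. \<forall>y\<in>Y. \<forall>n>0. \<forall>a \<in> N \<inter> word_ball G (S v) n.
    a \<otimes> y \<otimes> inv a \<in> word_ball G T (bound K n)"
  using assms(1,2)
proof (induction rule: finite_induct)
  case (insert y Y)
  then obtain K where K: "K > 0" "\<forall>y\<in>Y. \<forall>n>0. \<forall>a \<in> N \<inter> word_ball G (S v) n.
    a \<otimes> y \<otimes> inv a \<in> word_ball G T (bound K n)" by auto
  obtain L where L: "\<forall>n>0. \<forall>a \<in> N \<inter> word_ball G (S v) n. a \<otimes> y \<otimes> inv a \<in> word_ball G T (bound L n)"
    using conj_bounded[OF _ v, of y] insert.prems by auto
  have "word_ball G T (bound K n) \<subseteq> word_ball G T (bound (K + L) n)"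
    "word_ball G T (bound L n) \<subseteq> word_ball G T (bound (K + L) n)" for n
    by (intro word_ball_mono bound_mono; simp)+
  then show ?case using K L by (intro exI[of _ "K + L"]) blast
qed auto

text \<open>Write each Schreier generator as \<open>y z \<otimes> p z\<close> with
  \<open>y z \<in> H\<close> and \<open>p z\<close> in one vertex group \<open>A v\<close>.
  Collecting the factors \<open>p z\<close> on the right conjugates each \<open>y z\<close> by an
  element of \<open>A v \<inter> N\<close> of linear length; this happens at most \<open>n\<close>
  times.\<close>

theorem distortion_bound:
  "\<exists>K>0. \<forall>n>0. H \<inter> word_ball G \<Sigma> n \<subseteq> word_ball G T (n * bound K n)"
proof -
  obtain v where v: "v \<in> X" using X by blast
  obtain Z where Z: "finite Z" "Z \<subseteq> N"
    "\<And>n x. x \<in> N \<Longrightarrow> x \<in> word_ball G \<Sigma> n \<Longrightarrow>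
      \<exists>zs. length zs \<le> n \<and> set zs \<subseteq> Z \<and> x = word_prod G zs"
    using schreier[OF N finite_index \<Sigma>] by blast
  have Zc: "Z \<subseteq> carrier G" using Z(2) normal_carrier[OF N] by blast
  have "\<forall>z\<in>Z. \<exists>p\<in>A v. H #> p = H #> z"
    using normal_coset_lift[OF H A[OF v]] N_le_A[OF v] Z(2) by blast
  then obtain p where p: "\<And>z. z \<in> Z \<Longrightarrow> p z \<in> A v \<and> H #> p z = H #> z" by metis
  have pc: "p z \<in> carrier G" if "z \<in> Z" for z using p[OF that] A_carrier[OF v] by blast
  have pN: "p z \<in> N" if "z \<in> Z" for z
    using H_coset_N[of z "p z"] p[OF that] pc[OF that] that Z(2) by blast
  have pZ: "p ` Z \<subseteq> generate G (S v)" using p S(3)[OF v] by auto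
  obtain L where L: "L > 0" "\<And>n. word_ball G (p ` Z) n \<subseteq> word_ball G (S v) (L * n)"
    using word_ball_lipschitz[OF S_carrier[OF v] _ pZ] Z(1) by auto
  have pL: "p z \<in> word_ball G (S v) L" if "z \<in> Z" for z
  proof -
    have "p z \<in> word_ball G (p ` Z) 1" using that pc by (intro gen_in_word_ball) auto
    then show ?thesis using L(2)[of 1] by auto
  qed
  define y where "y z = z \<otimes> inv (p z)" for z
  have yH: "y z \<in> H" if "z \<in> Z" for z
    using normal_coset_eq_iff[OF H, of z "p z"] p[OF that] pc[OF that] that Zc
    by (auto simp: y_def)
  obtain K where K: "K > 0" "\<And>z n a. z \<in> Z \<Longrightarrow> n > 0 \<Longrightarrow> a \<in> N \<Longrightarrow> a \<in> word_ball G (S v) n \<Longrightarrow>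
      a \<otimes> y z \<otimes> inv a \<in> word_ball G T (bound K n)"
  proof -
    have "y ` Z \<subseteq> H" using yH by blast
    from conj_bounded_finite[OF finite_imageI[OF Z(1)] this v] show thesis
      using that by auto
  qed
  \<comment> \<open>The accumulated factor \<open>a\<close> moves past the next generator by
    \<open>a \<otimes> z = (a \<otimes> y z \<otimes> inv a) \<otimes> (a \<otimes> p z)\<close>.
    The number \<open>M\<close> bounds the length of all accumulated factors, so every conjugation
    has the same cost \<open>bound K M\<close>.\<close>
  have collect: "\<exists>b \<in> N \<inter> word_ball G (S v) (m + L * length zs).
      \<exists>\<eta> \<in> word_ball G T (length zs * bound K M). a \<otimes> word_prod G zs = \<eta> \<otimes> b"
    if "set zs \<subseteq> Z" "a \<in> N" "a \<in> word_ball G (S v) m" "m + L * length zs \<le> M" "M > 0" for zs a m M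
    using that
  proof (induction zs arbitrary: a m)
    case Nil
    then have "a \<in> carrier G" using normal_carrier[OF N] by blast
    then show ?case using Nil one_in_word_ball by (intro bexI[of _ a] bexI[of _ \<one>]) auto
  next
    case (Cons z zs)
    then have z: "z \<in> Z" and zs: "set zs \<subseteq> Z" by auto
    note cs = pc[OF z] subsetD[OF Zc z]
    have ac: "a \<in> carrier G" using Cons normal_carrier[OF N] by blast
    have wc: "word_prod G zs \<in> carrier G" using zs Zc by (intro word_prod_closed) blast
    have "a \<otimes> p z \<in> N" by (rule subgroup.m_closed[OF N_subgroup Cons.prems(2) pN[OF z]])
    moreover have "a \<otimes> p z \<in> word_ball G (S v) (m + L)"
      by (rule word_ball_mult[OF S_carrier[OF v] Cons.prems(3) pL[OF z]])
    moreover have "m + L + L * length zs \<le> M" using Cons.prems by simp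
    ultimately obtain b \<eta> where b: "b \<in> N" "b \<in> word_ball G (S v) (m + L + L * length zs)"
      and \<eta>: "\<eta> \<in> word_ball G T (length zs * bound K M)" "a \<otimes> p z \<otimes> word_prod G zs = \<eta> \<otimes> b"
      using Cons.IH[OF zs, of "a \<otimes> p z" "m + L"] Cons.prems(5) by blast
    have bc: "b \<in> carrier G" using b(1) normal_carrier[OF N] by blast
    have \<eta>c: "\<eta> \<in> carrier G" using \<eta>(1) word_ball_carrier[OF T_carrier] by blast
    have "a \<in> word_ball G (S v) M" using Cons.prems(3,4) word_ball_mono[of m M "S v"] by auto
    then have "a \<otimes> y z \<otimes> inv a \<in> word_ball G T (bound K M)"
      using K(2)[OF z Cons.prems(5,2)] by blast
    from word_ball_mult[OF T_carrier this \<eta>(1)]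
    have "a \<otimes> y z \<otimes> inv a \<otimes> \<eta> \<in> word_ball G T (length (z # zs) * bound K M)"
      by simp
    moreover have "a \<otimes> word_prod G (z # zs) = a \<otimes> y z \<otimes> inv a \<otimes> \<eta> \<otimes> b"
    proof -
      have "a \<otimes> word_prod G (z # zs) = a \<otimes> y z \<otimes> inv a \<otimes> (a \<otimes> p z \<otimes> word_prod G zs)"
        using ac cs wc by (simp add: y_def m_assoc)
      also have "\<dots> = a \<otimes> y z \<otimes> inv a \<otimes> (\<eta> \<otimes> b)" by (simp only: \<eta>(2))
      also have "\<dots> = a \<otimes> y z \<otimes> inv a \<otimes> \<eta> \<otimes> b"
        using ac cs \<eta>c bc by (simp add: y_def m_assoc)
      finally show ?thesis .
    qed
    ultimately show ?case using b
      by (intro bexI[of _ b] bexI[of _ "a \<otimes> y z \<otimes> inv a \<otimes> \<eta>"]) (auto simp: algebra_simps)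
  qed
  \<comment> \<open>The summand \<open>K * Suc L\<close> comes from rescaling the conjugation cost
    at \<open>L * n\<close>, the summand \<open>Suc L\<close> from the final factor in
    \<open>A v\<close>.\<close>
  have "x \<in> word_ball G T (n * bound (K * Suc L + Suc L) n)"
    if n: "n > 0" and x: "x \<in> H" "x \<in> word_ball G \<Sigma> n" for n x
  proof -
    obtain zs where zs: "length zs \<le> n" "set zs \<subseteq> Z" "x = word_prod G zs"
      using Z(3)[OF _ x(2)] x(1) H_le_N by blast
    have le: "0 + L * length zs \<le> L * n" using zs(1) by simp
    obtain b \<eta> where b: "b \<in> word_ball G (S v) (L * length zs)"
      and \<eta>: "\<eta> \<in> word_ball G T (length zs * bound K (L * n))" and eq: "\<one> \<otimes> word_prod G zs = \<eta> \<otimes> b"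
      using collect[OF zs(2) subgroup.one_closed[OF N_subgroup] one_in_word_ball le] n L(1) by auto
    have bc: "b \<in> carrier G" using b ball_S_A[OF v] A_carrier[OF v] by blast
    have \<eta>c: "\<eta> \<in> carrier G" using \<eta>(1) word_ball_carrier[OF T_carrier] by blast
    have x_eq: "x = \<eta> \<otimes> b" using eq zs(3) x(1) normal_carrier[OF H] by simp
    \<comment> \<open>Since \<open>x\<close> and \<open>\<eta>\<close> lie in \<open>H\<close>, the
      collected factor \<open>b\<close> lies in \<open>A v \<inter> H\<close>, and its length in
      \<open>T\<close> is bounded by \<open>F\<close>.\<close>
    have "\<eta> \<in> H" using \<eta> word_ball_subgroup[OF H_subgroup T(2)] by blast
    then have "inv \<eta> \<otimes> x \<in> H"
      using x(1) by (intro subgroup.m_closed[OF H_subgroup] subgroup.m_inv_closed[OF H_subgroup])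
    then have "b \<in> H" using x_eq \<eta>c bc by simp
    moreover have "b \<in> word_ball G (S v) (L * n)"
      using b word_ball_mono[of "L * length zs" "L * n" "S v"] le by auto
    ultimately have "b \<in> word_ball G T (F (L * n))" using F[OF v] ball_S_A[OF v] by blast
    from word_ball_mult[OF T_carrier \<eta> this]
    have "x \<in> word_ball G T (length zs * bound K (L * n) + F (L * n))" by (simp add: x_eq)
    moreover have "length zs * bound K (L * n) + F (L * n) \<le> n * bound (K * Suc L + Suc L) n"
    proof -
      have "length zs * bound K (L * n) \<le> n * bound (K * Suc L) n"
        using zs(1) bound_scale by (rule mult_le_mono)
      moreover have "F (L * n) \<le> n * bound (Suc L) n"
        using F_le_bound[of L n] n by (cases n) auto
      moreover have "n * (bound (K * Suc L) n + bound (Suc L) n) \<le> n * bound (K * Suc L + Suc L) n"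
        by (intro mult_le_mono bound_add order_refl)
      ultimately show ?thesis by (simp add: add_mult_distrib2)
    qed
    ultimately show ?thesis using word_ball_mono by blast
  qed
  then show ?thesis by (intro exI[of _ "K * Suc L + Suc L"]) auto
qed

end

section \<open>Alternating products in an amalgam\<close>

text \<open>The data of an amalgamated product, without any uniqueness of normal forms; that enters
  only with the locale \<open>amalgam\<close>.\<close>

locale generating_pair = group G for G (structure) +
  fixes P :: "bool \<Rightarrow> 'a set" and C :: "'a set"
  assumes P: "subgroup (P i) G" and C: "subgroup C G" and C_le_P: "C \<subseteq> P i"
    and generates: "generate G (P True \<union> P False) = carrier G"
begin

lemma P_carrier: "x \<in> P i \<Longrightarrow> x \<in> carrier G"
  using subgroup.mem_carrier[OF P] .

lemma C_carrier: "x \<in> C \<Longrightarrow> x \<in> carrier G"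
  using subgroup.mem_carrier[OF C] .

lemma C_in_P: "x \<in> C \<Longrightarrow> x \<in> P i"
  using C_le_P by blast

lemmas P_mult = subgroup.m_closed[OF P] and P_inv = subgroup.m_inv_closed[OF P]
  and C_mult = subgroup.m_closed[OF C] and C_inv = subgroup.m_inv_closed[OF C]

lemma C_mult_left_iff: "c \<in> C \<Longrightarrow> x \<in> carrier G \<Longrightarrow> c \<otimes> x \<in> C \<longleftrightarrow> x \<in> C"
  using C_mult[of "inv c" "c \<otimes> x"] C_mult[of c x] C_inv[of c] C_carrier[of c] by auto

lemma C_mult_right_iff: "c \<in> C \<Longrightarrow> x \<in> carrier G \<Longrightarrow> x \<otimes> c \<in> C \<longleftrightarrow> x \<in> C"
  using C_mult[of "x \<otimes> c" "inv c"] C_mult[of x c] C_inv[of c] C_carrier[of c]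
  by (auto simp: m_assoc)

text \<open>The index is the side of the first factor. In an amalgam it tells on which side of the
  base edge of the Bass-Serre tree the translate of that edge by the element lies.\<close>

inductive alternating :: "bool \<Rightarrow> 'a \<Rightarrow> bool" where
  base: "a \<in> P i \<Longrightarrow> a \<notin> C \<Longrightarrow> alternating i a"
| step: "a \<in> P i \<Longrightarrow> a \<notin> C \<Longrightarrow> alternating (\<not> i) x \<Longrightarrow> alternating i (a \<otimes> x)"

lemma alternating_carrier: "alternating i x \<Longrightarrow> x \<in> carrier G"
  by (induction rule: alternating.induct) (auto intro: P_carrier)

lemma alternating_mult_left:
  assumes "alternating i x" "c \<in> C"
  shows "alternating i (c \<otimes> x)"
  using assms(1)
proof cases
  case base
  then show ?thesis
    using assms(2) C_in_P C_mult_left_iff P_carrier by (intro alternating.base P_mult) auto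
next
  case (step a y)
  have "alternating i (c \<otimes> a \<otimes> y)"
    using step assms(2) C_in_P C_mult_left_iff P_carrier by (intro alternating.step P_mult) auto
  then show ?thesis
    using step assms(2) C_carrier P_carrier alternating_carrier by (simp add: m_assoc)
qed

text \<open>Right multiplication acts on the last factor. If a tail collapses into \<open>C\<close>,
  it is absorbed by the factor before it, which stays outside \<open>C\<close>; so the first side
  survives unless the whole product collapses, and then \<open>s\<close> belongs to that
  side.\<close>

lemma alternating_mult_right:
  assumes "alternating i x" "s \<in> P j"
  shows "alternating i (x \<otimes> s) \<or> (j = i \<and> x \<otimes> s \<in> C)"
  using assms(1)
proof (induction rule: alternating.induct)
  case (base a i)
  show ?case
  proof (cases "j = i")
    case True
    then show ?thesis using base assms(2) P_mult alternating.base by blast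
  next
    case False
    show ?thesis
    proof (cases "s \<in> C")
      case True
      then show ?thesis
        using base C_in_P C_mult_right_iff P_carrier by (intro disjI1 alternating.base P_mult) auto
    next
      case sC: False
      have "j = (\<not> i)" using False by auto
      then have "alternating (\<not> i) s" using alternating.base assms(2) sC by simp
      then show ?thesis using base alternating.step by blast
    qed
  qed
next
  case (step a i x)
  note c = P_carrier[OF step(1)] alternating_carrier[OF step(3)] P_carrier[OF assms(2)]
  show ?case
  proof (cases "x \<otimes> s \<in> C")
    case True
    have "alternating i (a \<otimes> (x \<otimes> s))"
      using True step(1,2) C_mult_right_iff[OF True c(1)]
      by (intro alternating.base P_mult[OF step(1) C_in_P]) auto
    then show ?thesis using c by (simp add: m_assoc)
  next
    case False
    then have "alternating i (a \<otimes> (x \<otimes> s))" using step alternating.step by blast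
    then show ?thesis using c by (simp add: m_assoc)
  qed
qed

lemma letter_cases: "s \<in> P True \<union> P False \<union> m_inv G ` (P True \<union> P False) \<Longrightarrow> \<exists>j. s \<in> P j"
  using P_inv by blast

lemma gens_carrier: "P True \<union> P False \<subseteq> carrier G"
  using P_carrier by blast

lemma carrier_induct [consumes 1, case_names one mult]:
  assumes "x \<in> carrier G" "Q \<one>"
    and "\<And>s x j. s \<in> P j \<Longrightarrow> x \<in> carrier G \<Longrightarrow> Q x \<Longrightarrow> Q (x \<otimes> s)"
  shows "Q x"
proof -
  \<comment> \<open>Letters are to be appended on the right, while
    \<open>generate_letter_induct\<close> prepends them; taking inverses exchanges the two.\<close>
  have "Q (inv y)" if "y \<in> generate G (P True \<union> P False)" for y
    using gens_carrier that
  proof (induction rule: generate_letter_induct)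
    case one
    then show ?case using assms(2) by simp
  next
    case (mult s x)
    obtain j where "s \<in> P j" using letter_cases[OF mult(1)] by blast
    then show ?case
      using assms(3)[of "inv s" j "inv x"] mult P_inv P_carrier by (simp add: inv_mult_group)
  qed
  from this[of "inv x"] show ?thesis using assms(1) generates by simp
qed

lemma in_C_or_alternating:
  assumes "x \<in> carrier G"
  shows "x \<in> C \<or> (\<exists>i. alternating i x)"
  using assms
proof (induction rule: carrier_induct)
  case one
  then show ?case using subgroup.one_closed[OF C] by blast
next
  case (mult s x j)
  show ?case
  proof (cases "x \<in> C")
    case True
    then have "x \<otimes> s \<in> P j" using mult C_in_P P_mult by blast
    then show ?thesis using alternating.base by blast
  next
    case False
    then show ?thesis using mult alternating_mult_right by blast
  qed
qed

text \<open>In the Bass--Serre tree, only finitely many edges separate a vertex from its translate.\<close>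

lemma alternating_mult_right_finite:
  assumes "t \<in> carrier G"
  shows "\<exists>B. finite B \<and> B \<subseteq> carrier G \<and>
    (\<forall>x i. alternating i x \<longrightarrow> alternating i (x \<otimes> t) \<or> x \<in> (\<Union>b\<in>B. C #> b))"
  using assms
proof (induction rule: carrier_induct)
  case one
  then show ?case using alternating_carrier by (intro exI[of _ "{}"]) auto
next
  case (mult s t j)
  then obtain B where B: "finite B" "B \<subseteq> carrier G"
    "\<And>x i. alternating i x \<Longrightarrow> alternating i (x \<otimes> t) \<or> x \<in> (\<Union>b\<in>B. C #> b)" by blast
  have s: "s \<in> carrier G" using mult P_carrier by blast
  \<comment> \<open>Given that \<open>x \<otimes> t\<close> is still on side \<open>i\<close>,
    multiplication by \<open>s\<close> fails only if
    \<open>x \<otimes> t \<otimes> s \<in> C\<close>, which confines \<open>x\<close> to this one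
    further coset.\<close>
  let ?b = "inv (t \<otimes> s)"
  have "alternating i (x \<otimes> (t \<otimes> s)) \<or> x \<in> (\<Union>b\<in>insert ?b B. C #> b)" if x: "alternating i x" for x i
  proof (cases "x \<in> (\<Union>b\<in>B. C #> b)")
    case False
    have xc: "x \<in> carrier G" using x alternating_carrier by blast
    have "alternating i (x \<otimes> t \<otimes> s) \<or> x \<otimes> t \<otimes> s \<in> C"
      using B(3)[OF x] False alternating_mult_right mult(1) by blast
    then show ?thesis
    proof
      assume "x \<otimes> t \<otimes> s \<in> C"
      moreover have "x = x \<otimes> t \<otimes> s \<otimes> ?b" using xc s mult(2) by (simp add: m_assoc inv_mult_group)
      ultimately have "x \<in> C #> ?b" unfolding r_coset_def by blast
      then show ?thesis by blast
    qed (use xc s mult(2) in \<open>simp add: m_assoc\<close>)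
  qed auto
  then show ?case using B s mult(2) by (intro exI[of _ "insert ?b B"]) auto
qed

end

text \<open>These are the two consequences of uniqueness of normal forms that are used: the side of
  an alternating product is well defined, and no such product lies in \<open>C\<close>.\<close>

locale amalgam = generating_pair +
  assumes alternating_disjoint: "alternating i x \<Longrightarrow> \<not> alternating (\<not> i) x"
    and alternating_not_in_C: "alternating i x \<Longrightarrow> x \<notin> C"
begin

text \<open>A coset \<open>g H\<close> that avoids finitely many cosets of \<open>C\<close> cannot
  change sides, since a generator of \<open>H\<close> changes sides only near the base edge. Moving
  \<open>g\<close> to the identity letter by letter puts \<open>H\<close> inside \<open>C\<close>
  together with one side, and conjugation by an element of the other side contradicts this.\<close>

theorem finite_double_cosets:
  assumes H: "H \<lhd> G" and T: "finite T" "T \<subseteq> H" "generate G T = H"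
    and not_le: "\<not> H \<subseteq> C" "\<And>i. P i \<noteq> C"
  shows "\<exists>B. finite B \<and> B \<subseteq> carrier G \<and> carrier G = (\<Union>b\<in>B. (C <#> H) #> b)"
proof -
  note HG = normal_imp_subgroup[OF H]
  have Hc: "h \<in> carrier G" if "h \<in> H" for h using normal_carrier[OF H that] .
  have Tc: "T \<subseteq> carrier G" using T(2) Hc by blast
  let ?T = "T \<union> m_inv G ` T"
  have Tc': "?T \<subseteq> carrier G" using letters_carrier[OF Tc] .
  have "\<forall>t\<in>carrier G. \<exists>B. finite B \<and> B \<subseteq> carrier G \<and>
    (\<forall>x i. alternating i x \<longrightarrow> alternating i (x \<otimes> t) \<or> x \<in> (\<Union>b\<in>B. C #> b))"
    by (intro ballI alternating_mult_right_finite)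
  from bchoice[OF this] obtain B where B: "\<forall>t\<in>carrier G. finite (B t) \<and> B t \<subseteq> carrier G \<and>
    (\<forall>x i. alternating i x \<longrightarrow> alternating i (x \<otimes> t) \<or> x \<in> (\<Union>b\<in>B t. C #> b))"
    by (elim exE)
  \<comment> \<open>The identity is included so that an element \<open>g\<close> outside the union
    is not in \<open>C\<close> and thus has a side.\<close>
  define D where "D = insert \<one> (\<Union>t\<in>?T. B t)"
  have D: "finite D" "D \<subseteq> carrier G" using B Tc' T(1) unfolding D_def by auto
  have "g \<in> (\<Union>b\<in>D. (C <#> H) #> b)" if g: "g \<in> carrier G" for g
  proof (rule ccontr)
    assume "g \<notin> (\<Union>b\<in>D. (C <#> H) #> b)"
    then have gD: "g \<notin> (C <#> H) #> b" if "b \<in> D" for b using that by (simp only: UN_iff bex_simps) metis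
    \<comment> \<open>Normality moves \<open>h\<close> past \<open>b\<close>, so missing
      \<open>(C <#> H) #> b\<close> means that no element of \<open>g H\<close> meets
      \<open>C #> b\<close>.\<close>
    have avoid: "g \<otimes> h \<notin> C #> b" if h: "h \<in> H" and b: "b \<in> D" for h b
    proof
      assume "g \<otimes> h \<in> C #> b"
      then obtain c where c: "c \<in> C" "g \<otimes> h = c \<otimes> b" unfolding r_coset_def by blast
      have bc: "b \<in> carrier G" using b D by blast
      note cs = g bc Hc[OF h] C_carrier[OF c(1)]
      have "g = g \<otimes> h \<otimes> inv h" using cs by (simp add: m_assoc)
      also have "\<dots> = c \<otimes> (b \<otimes> inv h \<otimes> inv b) \<otimes> b" unfolding c(2) using cs by (simp add: m_assoc)
      finally have eq: "g = c \<otimes> (b \<otimes> inv h \<otimes> inv b) \<otimes> b" .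
      have "b \<otimes> inv h \<otimes> inv b \<in> H"
        using normal.inv_op_closed2[OF H bc] subgroup.m_inv_closed[OF HG h] by blast
      then have "g \<in> (C <#> H) #> b" unfolding set_mult_def r_coset_def using eq c(1) by blast
      then show False using gD b by blast
    qed
    have "g \<notin> C"
      using avoid[OF subgroup.one_closed[OF HG], of \<one>] g coset_mult_one[OF subgroup.subset[OF C]]
      by (simp add: D_def)
    then obtain i where i: "alternating i g" using in_C_or_alternating[OF g] by blast
    have gH: "alternating i (g \<otimes> h)" if "h \<in> H" for h
    proof -
      \<comment> \<open>The inverse turns the letters prepended to \<open>k\<close> by the induction
        into right multiplications of \<open>g\<close>.\<close>
      have "alternating i (g \<otimes> inv k)" if "k \<in> generate G T" for k
      proof -
        have "k \<in> H \<and> alternating i (g \<otimes> inv k)"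
          using Tc that
        proof (induction rule: generate_letter_induct)
          case one
          then show ?case using i g subgroup.one_closed[OF HG] by simp
        next
          case (mult s k)
          have sH: "s \<in> H" using mult(1) T(2) subgroup.m_inv_closed[OF HG] by blast
          have s: "inv s \<in> ?T" using inv_letter[OF Tc mult(1)] .
          have "inv k \<in> H" using mult(3) subgroup.m_inv_closed[OF HG] by blast
          moreover have "B (inv s) \<subseteq> D" using s unfolding D_def by blast
          ultimately have "g \<otimes> inv k \<notin> (\<Union>b\<in>B (inv s). C #> b)"
            using avoid by blast
          then have "alternating i (g \<otimes> inv k \<otimes> inv s)"
            using bspec[OF B subsetD[OF Tc' s]] mult(3) by blast
          then show ?case
            using g mult(2,3) Hc[OF sH] subgroup.m_closed[OF HG sH] by (simp add: m_assoc inv_mult_group)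
        qed
        then show ?thesis by blast
      qed
      from this[of "inv h"] show ?thesis
        using T(3) subgroup.m_inv_closed[OF HG that] Hc[OF that] by simp
    qed
    have HC: "h \<in> C \<or> alternating i h" if h: "h \<in> H" for h
    proof -
      \<comment> \<open>As \<open>p\<close> grows from the identity, either the whole coset of
        \<open>g \<otimes> p\<close> remains on side \<open>i\<close>, or at some stage it meets
        \<open>C\<close>, and then left translation by an element of \<open>C\<close> gives the
        second alternative. At \<open>p = inv g\<close> both alternatives speak of
        \<open>H\<close>.\<close>
      have "(\<forall>h\<in>H. alternating i (g \<otimes> p \<otimes> h)) \<or> (\<forall>h\<in>H. h \<in> C \<or> alternating i h)"
        if "p \<in> carrier G" for p
        using that
      proof (induction rule: carrier_induct)
        case one
        then show ?case using gH g by simp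
      next
        case (mult s p j)
        have sc: "s \<in> carrier G" using mult P_carrier by blast
        show ?case
        proof (cases "\<forall>h\<in>H. alternating i (g \<otimes> p \<otimes> h)")
          case True
          have all: "alternating i (g \<otimes> (p \<otimes> s) \<otimes> h) \<or> g \<otimes> (p \<otimes> s) \<otimes> h \<in> C" if h: "h \<in> H" for h
          proof -
            have "s \<otimes> h \<otimes> inv s \<in> H" by (rule normal.inv_op_closed2[OF H sc h])
            then have "alternating i (g \<otimes> p \<otimes> (s \<otimes> h \<otimes> inv s))" using True by blast
            from alternating_mult_right[OF this mult(1)] show ?thesis
              using g mult(2) sc Hc[OF h] by (auto simp: m_assoc)
          qed
          show ?thesis
          proof (cases "\<exists>k\<in>H. g \<otimes> (p \<otimes> s) \<otimes> k \<in> C")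
            case True
            then obtain k where k: "k \<in> H" "g \<otimes> (p \<otimes> s) \<otimes> k \<in> C" by blast
            \<comment> \<open>All of \<open>H\<close> is written as \<open>inv ?c\<close> times the
              current coset, and left multiplication by \<open>C\<close> preserves sides.\<close>
            let ?c = "g \<otimes> (p \<otimes> s) \<otimes> k"
            have "h \<in> C \<or> alternating i h" if h: "h \<in> H" for h
            proof -
              have "k \<otimes> h \<in> H" by (rule subgroup.m_closed[OF HG k(1) h])
              from all[OF this] have "alternating i (?c \<otimes> h) \<or> ?c \<otimes> h \<in> C"
                using g mult(2) sc Hc[OF h] Hc[OF k(1)] by (simp add: m_assoc)
              then have "alternating i (inv ?c \<otimes> (?c \<otimes> h)) \<or> inv ?c \<otimes> (?c \<otimes> h) \<in> C"
                using alternating_mult_left C_mult C_inv[OF k(2)] by blast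
              then show ?thesis using C_carrier[OF k(2)] Hc[OF h] by auto
            qed
            then show ?thesis by blast
          qed (use all in blast)
        qed (use mult in blast)
      qed
      from this[of "inv g"] g h Hc show ?thesis by auto
    qed
    obtain h where h: "h \<in> H" "h \<notin> C" using not_le(1) by blast
    obtain b where b: "b \<in> P (\<not> i)" "b \<notin> C" using not_le(2)[of "\<not> i"] C_le_P by blast
    have bc: "b \<in> carrier G" using b P_carrier by blast
    \<comment> \<open>The collapsing alternative would require \<open>inv b\<close> to be on side
      \<open>i\<close>, so the side of \<open>h\<close> is kept; prefixing \<open>b\<close> then
      yields the opposite side.\<close>
    have "alternating i (h \<otimes> inv b)"
      using alternating_mult_right[of i h "inv b" "\<not> i"] HC[OF h(1)] h(2) P_inv[OF b(1)] by auto
    then have "alternating (\<not> i) (b \<otimes> (h \<otimes> inv b))"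
      using alternating.step[OF b] by simp
    then have alt: "alternating (\<not> i) (b \<otimes> h \<otimes> inv b)"
      using bc Hc[OF h(1)] by (simp add: m_assoc)
    have "b \<otimes> h \<otimes> inv b \<in> H" by (rule normal.inv_op_closed2[OF H bc h(1)])
    then show False
      using HC alt alternating_not_in_C alternating_disjoint by blast
  qed
  moreover have "g \<in> carrier G" if "g \<in> (\<Union>b\<in>D. (C <#> H) #> b)" for g
    using that D(2) r_coset_subset_G[OF set_mult_closed[OF subgroup.subset[OF C] subgroup.subset[OF HG]]]
    by blast
  ultimately have "carrier G = (\<Union>b\<in>D. (C <#> H) #> b)" by (intro equalityI subsetI)
  then show ?thesis using D by (intro exI conjI)
qed

end

section \<open>Normal forms in an amalgam\<close>

context generating_pair
begin

section \<open>Coset representatives\<close>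

definition rep :: "'a \<Rightarrow> 'a" where
  "rep x = (SOME y. y \<in> C #> x)"

lemma rep_in_coset:
  assumes "x \<in> carrier G"
  shows "rep x \<in> C #> x"
  unfolding rep_def using rcos_self[OF assms C] by (rule someI)

lemma rep_carrier [simp]: "x \<in> carrier G \<Longrightarrow> rep x \<in> carrier G"
  using rep_in_coset subgroup.elemrcos_carrier[OF C is_group] by blast

lemma rep_mult_left: "c \<in> C \<Longrightarrow> x \<in> carrier G \<Longrightarrow> rep (c \<otimes> x) = rep x"
  unfolding rep_def using coset_mult_assoc[of C c x] coset_join2[of c C] C subgroup.subset[OF C] C_carrier
  by simp

lemma rep_eq:
  assumes "x \<in> carrier G"
  obtains c where "c \<in> C" "rep x = c \<otimes> x"
  using rep_in_coset[OF assms] unfolding r_coset_def by blast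

lemma rep_rep: "x \<in> carrier G \<Longrightarrow> rep (rep x) = rep x"
  by (metis rep_eq rep_mult_left)

lemma mult_inv_rep_in_C:
  assumes "x \<in> carrier G"
  shows "x \<otimes> inv (rep x) \<in> C"
proof -
  obtain c where "c \<in> C" "rep x = c \<otimes> x" using rep_eq[OF assms] .
  then have "x \<otimes> inv (rep x) = inv c" "c \<in> C"
    using assms C_carrier by (auto simp: inv_mult_group simp flip: m_assoc)
  then show ?thesis using C_inv by simp
qed

lemma rep_in_P: "x \<in> P i \<Longrightarrow> rep x \<in> P i"
  by (metis P_carrier C_in_P P_mult rep_eq)

lemma rep_in_C_iff: "x \<in> carrier G \<Longrightarrow> rep x \<in> C \<longleftrightarrow> x \<in> C"
  by (metis C_mult_left_iff rep_eq)

text \<open>The pair \<open>(c, [(i\<^sub>1, r\<^sub>1), \<dots>, (i\<^sub>n, r\<^sub>n)])\<close> encodes the normal form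
  \<open>c r\<^sub>1 \<dots> r\<^sub>n\<close> in the amalgamated product of \<open>P True\<close> and \<open>P False\<close> over \<open>C\<close>.\<close>

fun reduced :: "(bool \<times> 'a) list \<Rightarrow> bool" where
  "reduced [] \<longleftrightarrow> True"
| "reduced ((i, r) # w) \<longleftrightarrow>
     r \<in> P i \<and> r \<notin> C \<and> rep r = r \<and> reduced w \<and> (w \<noteq> [] \<longrightarrow> fst (hd w) \<noteq> i)"

definition normal_forms :: "('a \<times> (bool \<times> 'a) list) set" where
  "normal_forms = {(c, w). c \<in> C \<and> reduced w}"

text \<open>A normal form whose leading factor from side \<open>i\<close>, if any, has been merged
  with the coefficient. On these pairs \<open>P i\<close> acts simply by left multiplication on the
  first component; \<open>unpack\<close> and \<open>pack\<close> are the mutually inverse bijections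
  with normal forms, and \<open>act\<close> transports the action along them.\<close>

definition open_forms :: "bool \<Rightarrow> ('a \<times> (bool \<times> 'a) list) set" where
  "open_forms i = {(x, w). x \<in> P i \<and> reduced w \<and> (w \<noteq> [] \<longrightarrow> fst (hd w) \<noteq> i)}"

definition unpack :: "bool \<Rightarrow> 'a \<times> (bool \<times> 'a) list \<Rightarrow> 'a \<times> (bool \<times> 'a) list" where
  "unpack i \<sigma> = (if snd \<sigma> \<noteq> [] \<and> fst (hd (snd \<sigma>)) = i
     then (fst \<sigma> \<otimes> snd (hd (snd \<sigma>)), tl (snd \<sigma>)) else \<sigma>)"

definition pack :: "bool \<Rightarrow> 'a \<times> (bool \<times> 'a) list \<Rightarrow> 'a \<times> (bool \<times> 'a) list" where
  "pack i \<sigma> = (if fst \<sigma> \<in> C then \<sigma>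
     else (fst \<sigma> \<otimes> inv (rep (fst \<sigma>)), (i, rep (fst \<sigma>)) # snd \<sigma>))"

definition act :: "bool \<Rightarrow> 'a \<Rightarrow> 'a \<times> (bool \<times> 'a) list \<Rightarrow> 'a \<times> (bool \<times> 'a) list" where
  "act i a \<sigma> = pack i (a \<otimes> fst (unpack i \<sigma>), snd (unpack i \<sigma>))"

lemma unpack_closed: "\<sigma> \<in> normal_forms \<Longrightarrow> unpack i \<sigma> \<in> open_forms i"
  unfolding normal_forms_def open_forms_def unpack_def
  by (cases "snd \<sigma>") (auto simp: C_in_P intro: P_mult)

lemma pack_closed: "\<sigma> \<in> open_forms i \<Longrightarrow> pack i \<sigma> \<in> normal_forms"
  unfolding normal_forms_def open_forms_def pack_def
  by (auto simp: mult_inv_rep_in_C P_carrier rep_in_P rep_in_C_iff rep_rep)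

lemma unpack_pack: "\<sigma> \<in> open_forms i \<Longrightarrow> unpack i (pack i \<sigma>) = \<sigma>"
  unfolding open_forms_def pack_def unpack_def
  by (auto simp: P_carrier m_assoc)

lemma pack_unpack:
  assumes "\<sigma> \<in> normal_forms"
  shows "pack i (unpack i \<sigma>) = \<sigma>"
proof -
  obtain c w where \<sigma>: "\<sigma> = (c, w)" "c \<in> C" "reduced w"
    using assms unfolding normal_forms_def by blast
  show ?thesis
  proof (cases "w \<noteq> [] \<and> fst (hd w) = i")
    case True
    then obtain r w' where w: "w = (i, r) # w'" by (cases w) auto
    then have "r \<in> P i" "r \<notin> C" "rep r = r" using \<sigma>(3) by auto
    then show ?thesis
      using w \<sigma>(1,2)
      by (simp add: pack_def unpack_def C_mult_left_iff rep_mult_left P_carrier C_carrier m_assoc)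
  qed (use \<sigma> in \<open>auto simp: pack_def unpack_def\<close>)
qed

lemma open_forms_mult: "a \<in> P i \<Longrightarrow> \<sigma> \<in> open_forms i \<Longrightarrow> (a \<otimes> fst \<sigma>, snd \<sigma>) \<in> open_forms i"
  unfolding open_forms_def by (auto intro: P_mult)

lemma act_closed: "a \<in> P i \<Longrightarrow> \<sigma> \<in> normal_forms \<Longrightarrow> act i a \<sigma> \<in> normal_forms"
  unfolding act_def by (intro pack_closed open_forms_mult unpack_closed)

lemma act_mult:
  assumes "a \<in> P i" "b \<in> P i" "\<sigma> \<in> normal_forms"
  shows "act i (a \<otimes> b) \<sigma> = act i a (act i b \<sigma>)"
proof -
  have "unpack i (act i b \<sigma>) = (b \<otimes> fst (unpack i \<sigma>), snd (unpack i \<sigma>))"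
    unfolding act_def using assms by (intro unpack_pack open_forms_mult unpack_closed)
  moreover have "fst (unpack i \<sigma>) \<in> P i"
    using unpack_closed[OF assms(3), of i] unfolding open_forms_def by auto
  ultimately show ?thesis
    using assms P_carrier by (simp add: act_def[of i a] act_def[of i "a \<otimes> b"] m_assoc)
qed

text \<open>The result does not mention \<open>i\<close>: the actions of \<open>P True\<close> and
  \<open>P False\<close> agree on \<open>C\<close>, which is what allows them to be glued.\<close>

lemma act_C:
  assumes "c \<in> C" "\<sigma> \<in> normal_forms"
  shows "act i c \<sigma> = (c \<otimes> fst \<sigma>, snd \<sigma>)"
proof -
  have *: "(c \<otimes> fst \<sigma>, snd \<sigma>) \<in> normal_forms"
    using assms C_mult unfolding normal_forms_def by auto
  have "(c \<otimes> fst (unpack i \<sigma>), snd (unpack i \<sigma>)) = unpack i (c \<otimes> fst \<sigma>, snd \<sigma>)"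
    using assms C_carrier unfolding unpack_def normal_forms_def
    by (cases "snd \<sigma>") (auto simp: m_assoc P_carrier)
  then show ?thesis unfolding act_def using pack_unpack[OF *, of i] by simp
qed

lemma act_one: "\<sigma> \<in> normal_forms \<Longrightarrow> act i \<one> \<sigma> = \<sigma>"
  using act_C[of \<one> \<sigma> i] subgroup.one_closed[OF C] C_carrier unfolding normal_forms_def by auto

text \<open>If \<open>G\<close> is the amalgamated product, it acts on the normal forms; the image of \<open>(\<one>, [])\<close>
  then reads off the first syllable of an alternating product.\<close>

lemma amalgamI:
  fixes \<Psi> :: "'a \<Rightarrow> 'a \<times> (bool \<times> 'a) list \<Rightarrow> 'a \<times> (bool \<times> 'a) list"
  assumes P_act: "\<And>i a \<sigma>. a \<in> P i \<Longrightarrow> \<sigma> \<in> normal_forms \<Longrightarrow> \<Psi> a \<sigma> = act i a \<sigma>"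
    and mult: "\<And>x y \<sigma>. x \<in> carrier G \<Longrightarrow> y \<in> carrier G \<Longrightarrow> \<sigma> \<in> normal_forms \<Longrightarrow>
      \<Psi> (x \<otimes> y) \<sigma> = \<Psi> x (\<Psi> y \<sigma>)"
  shows "amalgam G P C"
proof -
  have unit: "(\<one>, []) \<in> normal_forms"
    using subgroup.one_closed[OF C] unfolding normal_forms_def by simp
  have first: "\<Psi> x (\<one>, []) \<in> normal_forms \<and> snd (\<Psi> x (\<one>, [])) \<noteq> [] \<and>
      fst (hd (snd (\<Psi> x (\<one>, [])))) = i" if "alternating i x" for i x
    using that
  proof (induction rule: alternating.induct)
    case (base a i)
    have "act i a (\<one>, []) = pack i (a, [])"
      using base P_carrier unfolding act_def unpack_def by simp
    then show ?case
      using base P_act[OF base(1) unit] act_closed[OF base(1) unit] by (auto simp: pack_def)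
  next
    case (step a i x)
    let ?\<sigma> = "\<Psi> x (\<one>, [])"
    have "\<Psi> (a \<otimes> x) (\<one>, []) = act i a ?\<sigma>"
      using mult[OF P_carrier[OF step(1)] alternating_carrier[OF step(3)] unit] P_act[OF step(1)] step(4)
      by simp
    moreover have "act i a ?\<sigma> = pack i (a \<otimes> fst ?\<sigma>, snd ?\<sigma>)"
      using step(4) unfolding act_def unpack_def by simp
    \<comment> \<open>The coefficient of a normal form lies in \<open>C\<close>, so \<open>a\<close>
      times it stays outside \<open>C\<close> and packing creates a new leading syllable.\<close>
    moreover have "a \<otimes> fst ?\<sigma> \<notin> C"
      using step C_mult_right_iff P_carrier unfolding normal_forms_def by auto
    moreover have "act i a ?\<sigma> \<in> normal_forms" using act_closed[OF step(1)] step(4) by blast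
    ultimately show ?case by (simp add: pack_def)
  qed
  show ?thesis
  proof unfold_locales
    show "\<not> alternating (\<not> i) x" if "alternating i x" for i x
      using first[OF that] first[of "\<not> i" x] by auto
    show "x \<notin> C" if "alternating i x" for i x
    proof
      assume x: "x \<in> C"
      have "\<Psi> x (\<one>, []) = (x \<otimes> \<one>, [])"
        using P_act[OF C_in_P[OF x] unit] act_C[OF x unit] by simp
      then show False using first[OF that] by simp
    qed
  qed
qed

end

section \<open>Trees of groups\<close>

locale tree_of_groups =
  fixes \<Gamma> :: "('v, 'e, 'g, 'h) graph_of_groups"
  assumes simply_connected: "simply_connected_finite_graph_of_groups \<Gamma>"
begin

section \<open>Paths and separating edges in the tree\<close>

abbreviation "\<X> \<equiv> graph_of \<Gamma>"
abbreviation "V \<equiv> verts \<X>"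
abbreviation "rv \<equiv> reversal \<Gamma>"

lemma graph_of_groups: "is_graph_of_groups \<Gamma>" and finite_tree: "is_finite_tree \<X> rv"
  using simply_connected unfolding simply_connected_finite_graph_of_groups_def by auto

sublocale X: bidirected_digraph \<X> rv
  using finite_tree unfolding is_finite_tree_def by blast

sublocale X: fin_digraph \<X>
  using finite_tree unfolding is_finite_tree_def by blast

lemma rv_in_iff: "f \<in> {e, rv e} \<longleftrightarrow> rv f \<in> {e, rv e}"
  by (metis X.arev_arev insert_iff empty_iff)

text \<open>The set \<open>D\<close> is used only as the empty set or as \<open>{e, rv e}\<close>,
  that is, with one geometric edge removed.\<close>

definition steps :: "'v set \<Rightarrow> 'e set \<Rightarrow> ('v \<times> 'v) set" where
  "steps Y D = {(tail \<X> f, head \<X> f) | f. f \<in> arcs \<X> \<and> f \<notin> D \<and> tail \<X> f \<in> Y \<and> head \<X> f \<in> Y}"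

lemma steps_mono: "Y \<subseteq> Y' \<Longrightarrow> D' \<subseteq> D \<Longrightarrow> steps Y D \<subseteq> steps Y' D'"
  unfolding steps_def by blast

lemma sym_steps: "D = {} \<or> D = {e, rv e} \<Longrightarrow> sym (steps Y D)"
proof (rule symI)
  fix a b assume D: "D = {} \<or> D = {e, rv e}" and "(a, b) \<in> steps Y D"
  then obtain f where "f \<in> arcs \<X>" "f \<notin> D" "a = tail \<X> f" "b = head \<X> f" "a \<in> Y" "b \<in> Y"
    unfolding steps_def by blast
  moreover from this D have "rv f \<notin> D" using rv_in_iff[of f e] by auto
  ultimately show "(b, a) \<in> steps Y D"
    unfolding steps_def by (intro CollectI exI[of _ "rv f"]) auto
qed

lemma rtrancl_steps_sym:
  "D = {} \<or> D = {e, rv e} \<Longrightarrow> (a, b) \<in> (steps Y D)\<^sup>* \<Longrightarrow> (b, a) \<in> (steps Y D)\<^sup>*"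
  by (rule symD[OF sym_rtrancl[OF sym_steps]])

lemma V_connected: "V \<noteq> {}" "u \<in> V \<Longrightarrow> v \<in> V \<Longrightarrow> (u, v) \<in> (steps V {})\<^sup>*"
proof -
  have c: "strongly_connected (mk_symmetric \<X>)"
    using finite_tree unfolding is_finite_tree_def connected_def by blast
  then show "V \<noteq> {}" unfolding strongly_connected_def by simp
  assume "u \<in> V" "v \<in> V"
  then have "u \<rightarrow>\<^sup>*\<^bsub>mk_symmetric \<X>\<^esub> v" using c unfolding strongly_connected_def by simp
  then have "u \<rightarrow>\<^sup>*\<^bsub>\<X>\<^esub> v" using X.reachable_mk_symmetric_eq[OF X.sym_arcs] by blast
  then have "(u, v) \<in> (arcs_ends \<X>)\<^sup>*" unfolding reachable_def by (rule rtrancl_on_rtranclI)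
  moreover have "arcs_ends \<X> \<subseteq> steps V {}" unfolding steps_def arcs_ends_def arc_to_ends_def by auto
  ultimately show "(u, v) \<in> (steps V {})\<^sup>*" using rtrancl_mono by blast
qed

text \<open>If \<open>f\<close> and \<open>rv f\<close> were at positions \<open>i\<close> and
  \<open>j\<close>, distinctness of the visited vertices would give both \<open>i = Suc j\<close>
  and \<open>Suc i = j\<close>.\<close>

lemma apath_no_reversal:
  assumes "X.apath u p v" "f \<in> set p"
  shows "rv f \<notin> set p"
proof
  assume "rv f \<in> set p"
  then obtain i j where ij: "i < length p" "p ! i = f" "j < length p" "p ! j = rv f"
    using assms(2) by (metis in_set_conv_nth)
  have cas: "X.cas u p v" and d: "distinct (X.awalk_verts u p)" and f: "f \<in> arcs \<X>"
    using assms unfolding X.apath_def X.awalk_def by auto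
  have len: "length (X.awalk_verts u p) = Suc (length p)" by (rule X.length_awalk_verts)
  have t: "X.awalk_verts u p ! k = tail \<X> (p ! k)" if "k < length p" for k
    using that X.awalk_verts_conv[of u p] by (auto simp: nth_append)
  have h: "X.awalk_verts u p ! Suc k = head \<X> (p ! k)" if "k < length p" for k
    using that X.awalk_verts_conv'[OF cas] by auto
  have "X.awalk_verts u p ! i = X.awalk_verts u p ! Suc j" "X.awalk_verts u p ! Suc i = X.awalk_verts u p ! j"
    using t[OF ij(1)] h[OF ij(3)] h[OF ij(1)] t[OF ij(3)] ij f by auto
  then have "i = Suc j" "Suc i = j"
    using nth_eq_iff_index_eq[OF d] ij len by auto
  then show False by simp
qed

text \<open>Otherwise a walk avoiding the edge could be shortened to a simple path and closed up by
  \<open>e\<close> to a cycle without mutually reverse arcs, which the definition of a tree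
  forbids.\<close>

lemma edge_separates:
  assumes e: "e \<in> arcs \<X>"
  shows "(head \<X> e, tail \<X> e) \<notin> (steps V {e, rv e})\<^sup>*"
proof
  have walk: "\<exists>p. X.awalk (head \<X> e) p v \<and> set p \<inter> {e, rv e} = {}"
    if "(head \<X> e, v) \<in> (steps V {e, rv e})\<^sup>*" for v
    using that
  proof (induction rule: rtrancl_induct)
    case base
    then show ?case using e by (intro exI[of _ "[]"]) (auto simp: X.awalk_Nil_iff)
  next
    case (step a b)
    then obtain p f where "X.awalk (head \<X> e) p a" "set p \<inter> {e, rv e} = {}"
      "f \<in> arcs \<X>" "f \<notin> {e, rv e}" "a = tail \<X> f" "b = head \<X> f"
      unfolding steps_def by blast
    then show ?case
      by (intro exI[of _ "p @ [f]"]) (auto simp: X.awalk_Cons_iff X.awalk_Nil_iff)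
  qed
  assume "(head \<X> e, tail \<X> e) \<in> (steps V {e, rv e})\<^sup>*"
  then obtain q where q: "X.awalk (head \<X> e) q (tail \<X> e)" "set q \<inter> {e, rv e} = {}"
    using walk by blast
  define p where "p = X.awalk_to_apath q"
  have p: "X.apath (head \<X> e) p (tail \<X> e)" "set p \<inter> {e, rv e} = {}"
    using X.apath_awalk_to_apath[OF q(1)] X.awalk_to_apath_subset[OF q(1)] q(2)
    unfolding p_def by blast+
  have "X.cycle (e # p)"
    unfolding X.cycle_def using p(1) e
    by (intro exI[of _ "tail \<X> e"]) (auto simp: X.apath_def X.awalk_Cons_iff)
  moreover have "rv f \<notin> set (e # p)" if "f \<in> set (e # p)" for f
  proof (cases "f = e")
    case True
    then show ?thesis using p(2) X.arev_neq[OF e] by auto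
  next
    case False
    then have "f \<in> set p" using that by simp
    then have "rv f \<notin> set p" "f \<notin> {e, rv e}" using apath_no_reversal[OF p(1)] p(2) by blast+
    then show ?thesis using rv_in_iff[of f e] by auto
  qed
  ultimately show False using finite_tree unfolding is_finite_tree_def by blast
qed

section \<open>Vertex and edge subgroups of the fundamental group\<close>

abbreviation "\<G> \<equiv> tree_pi1 \<Gamma>"
abbreviation "cls \<equiv> pi1_class \<Gamma> (arcs \<X>)"
abbreviation "A \<equiv> vertex_subgroup \<Gamma>"
abbreviation "C \<equiv> edge_subgroup \<Gamma>"

sublocale G: group \<G>
  unfolding tree_pi1_def by (rule group_pi1[OF graph_of_groups])

lemma vertex_group: "v \<in> V \<Longrightarrow> group (vertex_group \<Gamma> v)"
  using graph_of_groups unfolding is_graph_of_groups_def by blast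

lemma nil_word: "[] \<in> pi1_words \<Gamma>"
  unfolding pi1_words_def by simp

lemma vertex_word: "v \<in> V \<Longrightarrow> g \<in> carrier (vertex_group \<Gamma> v) \<Longrightarrow> [Vertex_Letter v g] \<in> pi1_words \<Gamma>"
  unfolding pi1_words_def by auto

lemma append_word: "u \<in> pi1_words \<Gamma> \<Longrightarrow> w \<in> pi1_words \<Gamma> \<Longrightarrow> u @ w \<in> pi1_words \<Gamma>"
  unfolding pi1_words_def by auto

lemma cls_mult: "u \<in> pi1_words \<Gamma> \<Longrightarrow> w \<in> pi1_words \<Gamma> \<Longrightarrow> cls u \<otimes>\<^bsub>\<G>\<^esub> cls w = cls (u @ w)"
  unfolding tree_pi1_def by (rule pi1_mult)

lemma cls_eqI: "pi1_eq \<Gamma> (arcs \<X>) u w \<Longrightarrow> cls u = cls w"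
  using pi1_class_eq_iff pi1_eq_words[OF graph_of_groups] by metis

lemma cls_nil: "cls [] = \<one>\<^bsub>\<G>\<^esub>"
  unfolding tree_pi1_def pi1_def by simp

lemma carrier_cls: "carrier \<G> = cls ` pi1_words \<Gamma>"
  unfolding tree_pi1_def pi1_def by simp

lemma vertex_hom:
  assumes "v \<in> V"
  shows "group_hom (vertex_group \<Gamma> v) \<G> (\<lambda>g. cls [Vertex_Letter v g])"
proof -
  interpret B: group "vertex_group \<Gamma> v" using vertex_group[OF assms] .
  show ?thesis
  proof unfold_locales
    show "(\<lambda>g. cls [Vertex_Letter v g]) \<in> hom (vertex_group \<Gamma> v) \<G>"
      using assms vertex_word
      by (auto simp: hom_def carrier_cls cls_mult intro!: cls_eqI[symmetric] pi1_eq.vertex_mult)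
  qed
qed

lemma A_subgroup: "v \<in> V \<Longrightarrow> subgroup (A v) \<G>"
  unfolding vertex_subgroup_def using group_hom.img_is_subgroup[OF vertex_hom] by blast

lemma emb_hom:
  assumes "e \<in> arcs \<X>"
  shows "group_hom (edge_group \<Gamma> e) (vertex_group \<Gamma> (head \<X> e)) (edge_emb \<Gamma> e)"
  using assms graph_of_groups vertex_group[of "head \<X> e"]
  unfolding is_graph_of_groups_def group_hom_def group_hom_axioms_def by auto

lemma emb_closed:
  "e \<in> arcs \<X> \<Longrightarrow> x \<in> carrier (edge_group \<Gamma> e) \<Longrightarrow> edge_emb \<Gamma> e x \<in> carrier (vertex_group \<Gamma> (head \<X> e))"
  using group_hom.hom_closed[OF emb_hom] .

lemma edge_group_rv: "e \<in> arcs \<X> \<Longrightarrow> edge_group \<Gamma> (rv e) = edge_group \<Gamma> e"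
  using graph_of_groups unfolding is_graph_of_groups_def by blast

lemma C_subgroup:
  assumes "e \<in> arcs \<X>"
  shows "subgroup (C e) \<G>"
proof -
  have "C e = (\<lambda>g. cls [Vertex_Letter (head \<X> e) g]) ` edge_emb \<Gamma> e ` carrier (edge_group \<Gamma> e)"
    unfolding edge_subgroup_def by (simp add: image_image)
  moreover have "subgroup (edge_emb \<Gamma> e ` carrier (edge_group \<Gamma> e)) (vertex_group \<Gamma> (head \<X> e))"
    using group_hom.img_is_subgroup[OF emb_hom[OF assms]] .
  ultimately show ?thesis
    using group_hom.subgroup_img_is_subgroup[OF vertex_hom] assms by auto
qed

text \<open>All arc letters are trivial, so the edge relation identifies the two embeddings of the
  edge group.\<close>

lemma edge_cls:
  assumes e: "e \<in> arcs \<X>" and x: "x \<in> carrier (edge_group \<Gamma> e)"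
  shows "cls [Vertex_Letter (head \<X> e) (edge_emb \<Gamma> e x)] =
    cls [Vertex_Letter (tail \<X> e) (edge_emb \<Gamma> (rv e) x)]"
proof -
  let ?v = "Vertex_Letter (head \<X> e) (edge_emb \<Gamma> e x)"
  have "pi1_eq \<Gamma> (arcs \<X>) ([Arc_Letter e] @ [?v] @ [Arc_Letter (rv e)]) ([] @ [?v] @ [])"
    using e emb_closed[OF e x]
    by (intro pi1_eq.append pi1_eq.tree pi1_eq.refl vertex_word) auto
  moreover have "pi1_eq \<Gamma> (arcs \<X>) ([Arc_Letter e] @ [?v] @ [Arc_Letter (rv e)])
      [Vertex_Letter (tail \<X> e) (edge_emb \<Gamma> (rv e) x)]"
    using pi1_eq.edge[OF e x] by simp
  ultimately show ?thesis
    by (metis cls_eqI append_Nil append_Nil2)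
qed

lemma C_rv:
  assumes "e \<in> arcs \<X>"
  shows "C (rv e) = C e"
  unfolding edge_subgroup_def edge_group_rv[OF assms] X.head_arev[OF assms]
  using edge_cls[OF assms] by (intro image_cong) auto

lemma C_le_A_head: "e \<in> arcs \<X> \<Longrightarrow> C e \<subseteq> A (head \<X> e)"
  unfolding edge_subgroup_def vertex_subgroup_def using emb_closed by blast

lemma C_le_A_tail: "e \<in> arcs \<X> \<Longrightarrow> C e \<subseteq> A (tail \<X> e)"
  using C_le_A_head[of "rv e"] C_rv by simp

lemma A_carrier: "v \<in> V \<Longrightarrow> A v \<subseteq> carrier \<G>"
  using subgroup.subset[OF A_subgroup] .

lemma A_generate: "generate \<G> (\<Union>v\<in>V. A v) = carrier \<G>"
proof
  have sub: "(\<Union>v\<in>V. A v) \<subseteq> carrier \<G>" using A_carrier by blast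
  show "generate \<G> (\<Union>v\<in>V. A v) \<subseteq> carrier \<G>"
    using G.generate_in_carrier[OF sub] by blast
  have "cls u \<in> generate \<G> (\<Union>v\<in>V. A v)" if "u \<in> pi1_words \<Gamma>" for u
    using that
  proof (induction u)
    case Nil
    then show ?case by (simp add: cls_nil generate.one)
  next
    case (Cons l u)
    then have l: "[l] \<in> pi1_words \<Gamma>" and u: "u \<in> pi1_words \<Gamma>" by (auto simp: pi1_words_def)
    have "cls [l] \<in> generate \<G> (\<Union>v\<in>V. A v)"
    proof (cases l)
      case (Vertex_Letter v g)
      then have "v \<in> V" "cls [l] \<in> A v" using l by (auto simp: pi1_words_def vertex_subgroup_def)
      then show ?thesis by (blast intro: generate.incl)
    next
      case (Arc_Letter e)
      then have "cls [l] = cls []" using l by (intro cls_eqI) (auto simp: pi1_words_def intro: pi1_eq.tree)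
      then show ?thesis by (simp add: cls_nil generate.one)
    qed
    then show ?case
      using generate.eng[OF _ Cons.IH[OF u]] cls_mult[OF l u] by fastforce
  qed
  then show "carrier \<G> \<subseteq> generate \<G> (\<Union>v\<in>V. A v)" unfolding carrier_cls by blast
qed

end

section \<open>Minimal generating subtrees\<close>

context tree_of_groups
begin

section \<open>The splitting of the group over an edge\<close>

definition half :: "'e \<Rightarrow> 'v set" where
  "half e = {v. (head \<X> e, v) \<in> (steps V {e, rv e})\<^sup>*}"

lemma head_in_half: "head \<X> e \<in> half e"
  unfolding half_def by simp

lemma tail_notin_half: "e \<in> arcs \<X> \<Longrightarrow> tail \<X> e \<notin> half e"
  unfolding half_def using edge_separates by simp

lemma half_step:
  assumes "f \<in> arcs \<X>" "f \<notin> {e, rv e}"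
  shows "head \<X> f \<in> half e \<longleftrightarrow> tail \<X> f \<in> half e"
proof -
  have s: "(tail \<X> f, head \<X> f) \<in> steps V {e, rv e}"
    using assms unfolding steps_def by auto
  then have "(head \<X> f, tail \<X> f) \<in> steps V {e, rv e}"
    using symD[OF sym_steps] by blast
  with s show ?thesis unfolding half_def by (auto intro: rtrancl_into_rtrancl)
qed

text \<open>Cutting the edge leaves two subtrees; \<open>True\<close> is the one containing the
  head. Their vertex groups generate the two factors of the amalgam.\<close>

definition side :: "'e \<Rightarrow> bool \<Rightarrow> ('v, 'e, 'g) letter list set set" where
  "side e i = generate \<G> (\<Union>v\<in>{v\<in>V. (v \<in> half e) = i}. A v)"

lemma side_gens: "(\<Union>v\<in>{v\<in>V. (v \<in> half e) = i}. A v) \<subseteq> carrier \<G>"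
  using A_carrier by blast

lemma A_le_side: "v \<in> V \<Longrightarrow> A v \<subseteq> side e (v \<in> half e)"
  unfolding side_def by (blast intro: generate.incl)

lemma generating_pair:
  assumes e: "e \<in> arcs \<X>"
  shows "generating_pair \<G> (side e) (C e)"
proof (intro generating_pair.intro generating_pair_axioms.intro G.is_group)
  show sub: "subgroup (side e i) \<G>" for i
    unfolding side_def by (rule G.generate_is_subgroup[OF side_gens])
  show "subgroup (C e) \<G>" by (rule C_subgroup[OF e])
  show "C e \<subseteq> side e i" for i
    using A_le_side[of "head \<X> e" e] A_le_side[of "tail \<X> e" e] head_in_half[of e]
      tail_notin_half[OF e] C_le_A_head[OF e] C_le_A_tail[OF e] e by (cases i) auto
  have gens: "(\<Union>v\<in>V. A v) \<subseteq> side e True \<union> side e False"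
  proof (rule UN_least)
    fix v assume "v \<in> V"
    then show "A v \<subseteq> side e True \<union> side e False"
      using A_le_side[of v e] by (cases "v \<in> half e") auto
  qed
  have "side e True \<union> side e False \<subseteq> carrier \<G>"
    using subgroup.subset[OF sub] by blast
  then show "generate \<G> (side e True \<union> side e False) = carrier \<G>"
    using G.mono_generate[OF gens] G.generate_in_carrier unfolding A_generate by blast
qed

text \<open>Words act on normal forms built from the subgroups \<open>side e i\<close> and
  \<open>C e\<close> of the group itself. Once all defining relations are seen to hold for this
  action, it descends to the group and \<open>amalgamI\<close> applies.\<close>

lemma edge_amalgam:
  assumes e: "e \<in> arcs \<X>"
  shows "amalgam \<G> (side e) (C e)"
proof -
  interpret P: generating_pair \<G> "side e" "C e" by (rule generating_pair[OF e])
  define letter_act where "letter_act l = (case l of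
      Vertex_Letter v g \<Rightarrow> P.act (v \<in> half e) (cls [Vertex_Letter v g]) | Arc_Letter f \<Rightarrow> id)"
    for l :: "('v, 'e, 'g) letter"
  define run where "run u \<sigma> = foldr letter_act u \<sigma>" for u \<sigma>
  have cls_side: "cls [Vertex_Letter v g] \<in> side e (v \<in> half e)"
    if "v \<in> V" "g \<in> carrier (vertex_group \<Gamma> v)" for v g
    using that A_le_side[OF that(1)] unfolding vertex_subgroup_def by blast
  have run_append: "run (u @ w) \<sigma> = run u (run w \<sigma>)" for u w \<sigma>
    by (simp add: run_def)
  have run_closed: "run u \<sigma> \<in> P.normal_forms" if "u \<in> pi1_words \<Gamma>" "\<sigma> \<in> P.normal_forms" for u \<sigma>
    using that
  proof (induction u)
    case (Cons l u)
    then have IH: "run u \<sigma> \<in> P.normal_forms" by (simp add: pi1_words_def)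
    have "[l] \<in> pi1_words \<Gamma>" using Cons.prems by (auto simp: pi1_words_def)
    then have "letter_act l (run u \<sigma>) \<in> P.normal_forms"
      using IH cls_side
      by (cases l) (auto simp: letter_act_def pi1_words_def intro: P.act_closed)
    then show ?case by (simp add: run_def)
  qed (simp add: run_def)
  have run_eq: "run u \<sigma> = run w \<sigma>" if "pi1_eq \<Gamma> (arcs \<X>) u w" "\<sigma> \<in> P.normal_forms" for u w \<sigma>
    using that
  proof (induction arbitrary: \<sigma> rule: pi1_eq.induct)
    case (append u u' w w')
    have "w' \<in> pi1_words \<Gamma>" using pi1_eq_words[OF graph_of_groups append(2)] by blast
    then show ?case
      using append.IH(1)[of "run w' \<sigma>"] append.IH(2)[OF append.prems] run_closed append.prems
      by (simp add: run_append)
  next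
    case (vertex_one v)
    then have "cls [Vertex_Letter v \<one>\<^bsub>vertex_group \<Gamma> v\<^esub>] = \<one>\<^bsub>\<G>\<^esub>"
      using group_hom.hom_one[OF vertex_hom] by blast
    then show ?case using vertex_one by (simp add: run_def letter_act_def P.act_one)
  next
    case (vertex_mult v g h)
    have "cls [Vertex_Letter v (g \<otimes>\<^bsub>vertex_group \<Gamma> v\<^esub> h)] =
        cls [Vertex_Letter v g] \<otimes>\<^bsub>\<G>\<^esub> cls [Vertex_Letter v h]"
      using group_hom.hom_mult[OF vertex_hom[OF vertex_mult(1)]] vertex_mult by blast
    then show ?case
      using vertex_mult cls_side by (simp add: run_def letter_act_def P.act_mult)
  next
    case (edge f x)
    define c where "c = cls [Vertex_Letter (head \<X> f) (edge_emb \<Gamma> f x)]"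
    have c': "c = cls [Vertex_Letter (tail \<X> f) (edge_emb \<Gamma> (rv f) x)]"
      unfolding c_def by (rule edge_cls[OF edge(1,2)])
    \<comment> \<open>An edge other than \<open>e\<close> has both ends on the same side; for
      \<open>e\<close> itself the element lies in \<open>C e\<close>, which acts identically from
      both sides.\<close>
    have "P.act (head \<X> f \<in> half e) c \<sigma> = P.act (tail \<X> f \<in> half e) c \<sigma>"
    proof (cases "f \<in> {e, rv e}")
      case True
      have "c \<in> C f" unfolding c_def edge_subgroup_def using edge(2) by blast
      then have "c \<in> C e" using True C_rv[OF e] by auto
      then show ?thesis using P.act_C edge(3) by simp
    next
      case False
      then show ?thesis using half_step[OF edge(1)] by simp
    qed
    then show ?case by (simp add: run_def letter_act_def c_def c'[unfolded c_def])
  qed (auto simp: run_def letter_act_def)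
  \<comment> \<open>An arbitrary word representing \<open>x\<close> is run; \<open>run_eq\<close>
    makes the choice irrelevant on normal forms.\<close>
  define \<Psi> where "\<Psi> x = run (SOME u. u \<in> pi1_words \<Gamma> \<and> cls u = x)" for x
  have \<Psi>: "\<Psi> (cls u) \<sigma> = run u \<sigma>" if "u \<in> pi1_words \<Gamma>" "\<sigma> \<in> P.normal_forms" for u \<sigma>
  proof -
    define w where "w = (SOME w. w \<in> pi1_words \<Gamma> \<and> cls w = cls u)"
    have w: "w \<in> pi1_words \<Gamma>" "cls w = cls u"
      using someI[of "\<lambda>w. w \<in> pi1_words \<Gamma> \<and> cls w = cls u" u] that(1) unfolding w_def by auto
    then have "pi1_eq \<Gamma> (arcs \<X>) u w" using pi1_class_eq_iff[OF w(1)] by blast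
    then show ?thesis using run_eq that(2) unfolding \<Psi>_def w_def[symmetric] by simp
  qed
  have \<Psi>_closed: "\<Psi> x \<sigma> \<in> P.normal_forms" if x: "x \<in> carrier \<G>" "\<sigma> \<in> P.normal_forms" for x \<sigma>
  proof -
    obtain u where u: "u \<in> pi1_words \<Gamma>" "x = cls u" using x(1) unfolding carrier_cls by blast
    then show ?thesis using \<Psi>[OF u(1) x(2)] run_closed[OF u(1) x(2)] by simp
  qed
  have \<Psi>_mult: "\<Psi> (x \<otimes>\<^bsub>\<G>\<^esub> y) \<sigma> = \<Psi> x (\<Psi> y \<sigma>)"
    if x: "x \<in> carrier \<G>" "y \<in> carrier \<G>" "\<sigma> \<in> P.normal_forms" for x y \<sigma>
  proof -
    obtain u w where uw: "u \<in> pi1_words \<Gamma>" "x = cls u" "w \<in> pi1_words \<Gamma>" "y = cls w"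
      using x(1,2) unfolding carrier_cls by blast
    then show ?thesis
      using \<Psi>[OF append_word[OF uw(1,3)] x(3)] \<Psi>[OF uw(3) x(3)]
        \<Psi>[OF uw(1) run_closed[OF uw(3) x(3)]] by (simp add: cls_mult run_append)
  qed
  have \<Psi>_vertex: "\<Psi> a \<sigma> = P.act (v \<in> half e) a \<sigma>"
    if x: "v \<in> V" "a \<in> A v" "\<sigma> \<in> P.normal_forms" for v a \<sigma>
  proof -
    obtain g where g: "g \<in> carrier (vertex_group \<Gamma> v)" "a = cls [Vertex_Letter v g]"
      using x(2) unfolding vertex_subgroup_def by blast
    then show ?thesis
      using \<Psi>[OF vertex_word[OF x(1) g(1)] x(3)] by (simp add: run_def letter_act_def)
  qed
  have \<Psi>_act: "\<Psi> a \<sigma> = P.act i a \<sigma>" if a: "a \<in> side e i" and \<sigma>: "\<sigma> \<in> P.normal_forms" for i a \<sigma>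
  proof -
    \<comment> \<open>Agreement is known on single vertex groups and spreads by multiplicativity.
      Membership in the side is carried along because \<open>P.act_mult\<close> requires it.\<close>
    have "a \<in> side e i \<and> \<Psi> a \<sigma> = P.act i a \<sigma>"
      using side_gens a[unfolded side_def]
    proof (induction rule: G.generate_letter_induct)
      case one
      then show ?case
        using subgroup.one_closed[OF P.P] \<Psi>[OF nil_word \<sigma>] P.act_one[OF \<sigma>]
        by (simp add: cls_nil run_def)
    next
      case (mult s x)
      then obtain v where v: "v \<in> V" "(v \<in> half e) = i" and "s \<in> A v \<union> m_inv \<G> ` A v" by blast
      then have s: "s \<in> A v" using subgroup.m_inv_closed[OF A_subgroup] by blast
      then have "s \<in> side e i" using A_le_side[OF v(1), of e] v(2) by blast
      moreover have "s \<in> carrier \<G>" using s A_carrier[OF v(1)] by blast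
      ultimately show ?case
        using mult v s \<Psi>_vertex[OF v(1) s] \<Psi>_mult[OF _ _ \<sigma>] \<Psi>_closed[OF mult(2) \<sigma>] \<sigma>
        by (simp add: P.act_mult subgroup.m_closed[OF P.P])
    qed
    then show ?thesis by blast
  qed
  show ?thesis by (rule P.amalgamI[OF \<Psi>_act \<Psi>_mult])
qed

section \<open>Subtrees whose vertex groups generate\<close>

definition generating_subtree :: "'v set \<Rightarrow> bool" where
  "generating_subtree Y \<longleftrightarrow> Y \<subseteq> V \<and> Y \<noteq> {} \<and> (\<forall>u\<in>Y. \<forall>v\<in>Y. (u, v) \<in> (steps Y {})\<^sup>*) \<and>
     generate \<G> (\<Union>v\<in>Y. A v) = carrier \<G>"

lemma minimal_generating_subtree:
  obtains Y where "generating_subtree Y" "\<And>Z. Z \<subset> Y \<Longrightarrow> \<not> generating_subtree Z"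
proof -
  have V: "generating_subtree V"
    unfolding generating_subtree_def using V_connected A_generate by auto
  obtain Y where Y: "generating_subtree Y" "\<And>Z. generating_subtree Z \<Longrightarrow> card Y \<le> card Z"
    using arg_min_nat_lemma[of generating_subtree V card] V by blast
  have "\<not> generating_subtree Z" if "Z \<subset> Y" for Z
  proof -
    have "finite Y" using Y(1) X.finite_verts finite_subset unfolding generating_subtree_def by blast
    then have "card Z < card Y" using that by (rule psubset_card_mono)
    then show ?thesis using Y(2)[of Z] by auto
  qed
  with Y(1) show thesis using that by blast
qed

text \<open>If every vertex group on the tail side of \<open>e\<close> within \<open>Y\<close> were
  contained in \<open>C e\<close>, hence in the vertex group at the head, that side could be deleted
  from \<open>Y\<close> without losing generation, against minimality.\<close>

lemma split_subtree:
  assumes Y: "generating_subtree Y" "\<And>Z. Z \<subset> Y \<Longrightarrow> \<not> generating_subtree Z"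
    and e: "e \<in> arcs \<X>" "head \<X> e \<in> Y" "tail \<X> e \<in> Y"
  shows "\<exists>v\<in>Y. (tail \<X> e, v) \<in> (steps Y {e, rv e})\<^sup>* \<and> \<not> A v \<subseteq> C e"
proof (rule ccontr)
  assume neg: "\<not> ?thesis"
  have YV: "Y \<subseteq> V" using Y(1) unfolding generating_subtree_def by blast
  let ?D = "{e, rv e}"
  \<comment> \<open>What remains of \<open>Y\<close> after the deletion: the component of the head
    of \<open>e\<close>.\<close>
  define Z where "Z = {v\<in>Y. (head \<X> e, v) \<in> (steps Y ?D)\<^sup>*}"
  have "Z \<subseteq> half e"
    unfolding Z_def half_def using rtrancl_mono[OF steps_mono[OF YV, of ?D ?D]] by blast
  then have "tail \<X> e \<notin> Z" using tail_notin_half[OF e(1)] by blast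
  then have ZY: "Z \<subset> Y" using e(3) unfolding Z_def by blast
  have head_Z: "head \<X> e \<in> Z" using e(2) unfolding Z_def by simp
  have cover: "v \<in> Z \<or> (tail \<X> e, v) \<in> (steps Y ?D)\<^sup>*" if "v \<in> Y" for v
  proof -
    have "(head \<X> e, v) \<in> (steps Y {})\<^sup>*"
      using Y(1) e(2) that unfolding generating_subtree_def by blast
    then show ?thesis
    proof (induction rule: rtrancl_induct)
      case base
      then show ?case using head_Z by blast
    next
      case (step a b)
      then obtain f where f: "f \<in> arcs \<X>" "a = tail \<X> f" "b = head \<X> f" "a \<in> Y" "b \<in> Y"
        unfolding steps_def by blast
      consider "f = e" | "f = rv e" | "(a, b) \<in> steps Y ?D"
        using f unfolding steps_def by blast
      then show ?case
      proof cases
        case 1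
        then show ?thesis using f head_Z by simp
      next
        case 2
        then show ?thesis using f e(1) by simp
      next
        case 3
        then show ?thesis
          using step(3) f(5) unfolding Z_def by (auto intro: rtrancl_into_rtrancl)
      qed
    qed
  qed
  have conn: "(head \<X> e, v) \<in> (steps Z {})\<^sup>*" if "(head \<X> e, v) \<in> (steps Y ?D)\<^sup>*" for v
    using that
  proof (induction rule: rtrancl_induct)
    case (step a b)
    have "a \<in> Y" "b \<in> Y" using step(2) unfolding steps_def by auto
    moreover have "(head \<X> e, b) \<in> (steps Y ?D)\<^sup>*" using step(1,2) by (rule rtrancl_into_rtrancl)
    ultimately have "a \<in> Z" "b \<in> Z" using step(1) unfolding Z_def by auto
    then have "(a, b) \<in> steps Z {}" using step(2) unfolding steps_def by blast
    then show ?case using step(3) by (rule rtrancl_into_rtrancl[rotated])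
  qed simp
  have "(u, v) \<in> (steps Z {})\<^sup>*" if "u \<in> Z" "v \<in> Z" for u v
    using that conn rtrancl_steps_sym[of "{}"] unfolding Z_def by (blast intro: rtrancl_trans)
  moreover have "generate \<G> (\<Union>v\<in>Z. A v) = carrier \<G>"
  proof
    have sub: "(\<Union>v\<in>Z. A v) \<subseteq> carrier \<G>" using A_carrier ZY YV by blast
    show "generate \<G> (\<Union>v\<in>Z. A v) \<subseteq> carrier \<G>" using G.generate_in_carrier[OF sub] by blast
    have "A v \<subseteq> (\<Union>v\<in>Z. A v)" if "v \<in> Y" for v
    proof (cases "v \<in> Z")
      case False
      then have "A v \<subseteq> C e" using cover[OF that] neg that by blast
      then show ?thesis using C_le_A_head[OF e(1)] head_Z by blast
    qed blast
    then have "(\<Union>v\<in>Y. A v) \<subseteq> (\<Union>v\<in>Z. A v)" by blast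
    from G.mono_generate[OF this] show "carrier \<G> \<subseteq> generate \<G> (\<Union>v\<in>Z. A v)"
      using Y(1) unfolding generating_subtree_def by simp
  qed
  ultimately have "generating_subtree Z"
    unfolding generating_subtree_def using ZY YV head_Z by blast
  then show False using Y(2) ZY by blast
qed

text \<open>This makes the amalgam over \<open>e\<close> nontrivial on both sides.
  \<open>split_subtree\<close> speaks of the tail side; the head side follows by applying it to the
  reverse arc.\<close>

lemma side_neq_C:
  assumes Y: "generating_subtree Y" "\<And>Z. Z \<subset> Y \<Longrightarrow> \<not> generating_subtree Z"
    and e: "e \<in> arcs \<X>" "head \<X> e \<in> Y" "tail \<X> e \<in> Y"
  shows "side e i \<noteq> C e"
proof
  assume eq: "side e i = C e"
  have YV: "Y \<subseteq> V" using Y(1) unfolding generating_subtree_def by blast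
  note mono = rtrancl_mono[OF steps_mono[OF YV order_refl], of "{e, rv e}"]
  show False
  proof (cases i)
    case True
    have "rv e \<in> arcs \<X>" "head \<X> (rv e) \<in> Y" "tail \<X> (rv e) \<in> Y" using e by auto
    from split_subtree[OF Y this] obtain v where v: "v \<in> Y" "(head \<X> e, v) \<in> (steps Y {e, rv e})\<^sup>*"
      "\<not> A v \<subseteq> C e"
      using e(1) C_rv[OF e(1)] by (auto simp: insert_commute)
    then have "v \<in> half e" unfolding half_def using mono by blast
    then show False using A_le_side[of v e] v YV eq True by auto
  next
    case False
    obtain v where v: "v \<in> Y" "(tail \<X> e, v) \<in> (steps Y {e, rv e})\<^sup>*" "\<not> A v \<subseteq> C e"
      using split_subtree[OF Y e] by blast
    have "(v, tail \<X> e) \<in> (steps V {e, rv e})\<^sup>*"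
      using rtrancl_steps_sym[of "{e, rv e}" e] v(2) mono by blast
    then have "v \<notin> half e"
      using tail_notin_half[OF e(1)] unfolding half_def by (auto intro: rtrancl_trans)
    then show False using A_le_side[of v e] v YV eq False by auto
  qed
qed

end

section \<open>Finite index and the distortion bound\<close>

context group
begin

text \<open>The intersection of all conjugates of the \<open>K i\<close> is the kernel of right
  translation on the finitely many cosets of all \<open>K i\<close>, so it has finite index. It
  contains \<open>H\<close> because \<open>H\<close> is normal.\<close>

lemma normal_core_finite_index:
  assumes I: "finite I" and K: "\<And>i. i \<in> I \<Longrightarrow> subgroup (K i) G" "\<And>i. i \<in> I \<Longrightarrow> finite (rcosets (K i))"
    and H: "H \<lhd> G" "\<And>i. i \<in> I \<Longrightarrow> H \<subseteq> K i"
  shows "\<exists>N. N \<lhd> G \<and> finite (rcosets N) \<and> H \<subseteq> N \<and> (\<forall>i\<in>I. N \<subseteq> K i)"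
proof -
  define N where "N = {g \<in> carrier G. \<forall>i\<in>I. \<forall>x\<in>carrier G. x \<otimes> g \<otimes> inv x \<in> K i}"
  have NG: "subgroup N G"
  proof (rule subgroupI)
    show "N \<subseteq> carrier G" unfolding N_def by blast
    show "N \<noteq> {}"
      unfolding N_def using subgroup.one_closed[OF K(1)] by (auto intro!: exI[of _ \<one>])
    show "inv a \<in> N" if "a \<in> N" for a
    proof -
      have a: "a \<in> carrier G" using that unfolding N_def by blast
      have "x \<otimes> inv a \<otimes> inv x \<in> K i" if "i \<in> I" "x \<in> carrier G" for i x
      proof -
        have "x \<otimes> inv a \<otimes> inv x = inv (x \<otimes> a \<otimes> inv x)"
          using a that(2) by (simp add: inv_mult_group m_assoc)
        then show ?thesis
          using subgroup.m_inv_closed[OF K(1)[OF that(1)]] \<open>a \<in> N\<close> that unfolding N_def by simp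
      qed
      then show ?thesis using a unfolding N_def by simp
    qed
    show "a \<otimes> b \<in> N" if ab: "a \<in> N" "b \<in> N" for a b
    proof -
      have c: "a \<in> carrier G" "b \<in> carrier G" using ab unfolding N_def by blast+
      have "x \<otimes> (a \<otimes> b) \<otimes> inv x \<in> K i" if "i \<in> I" "x \<in> carrier G" for i x
      proof -
        have "x \<otimes> (a \<otimes> b) \<otimes> inv x = x \<otimes> a \<otimes> inv x \<otimes> (x \<otimes> b \<otimes> inv x)"
          using c that(2) by (simp add: m_assoc)
        then show ?thesis
          using subgroup.m_closed[OF K(1)[OF that(1)]] ab that unfolding N_def by simp
      qed
      then show ?thesis using c unfolding N_def by simp
    qed
  qed
  have "N \<lhd> G"
    unfolding normal_inv_iff
  proof (intro conjI NG ballI)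
    fix y g assume y: "y \<in> carrier G" and g: "g \<in> N"
    have gc: "g \<in> carrier G" using g unfolding N_def by blast
    have "x \<otimes> (y \<otimes> g \<otimes> inv y) \<otimes> inv x = (x \<otimes> y) \<otimes> g \<otimes> inv (x \<otimes> y)" if "x \<in> carrier G" for x
      using that y gc by (simp add: m_assoc inv_mult_group)
    then show "y \<otimes> g \<otimes> inv y \<in> N" using g y gc unfolding N_def by simp
  qed
  moreover have "H \<subseteq> N"
    using H(2) normal.inv_op_closed2[OF H(1)] normal_carrier[OF H(1)] unfolding N_def by blast
  moreover have "N \<subseteq> K i" if i: "i \<in> I" for i
  proof
    fix g assume "g \<in> N"
    then have "\<one> \<otimes> g \<otimes> inv \<one> \<in> K i" "g \<in> carrier G" unfolding N_def using i by blast+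
    then show "g \<in> K i" by simp
  qed
  moreover have "finite (rcosets N)"
  proof -
    \<comment> \<open>\<open>D\<close> is the disjoint union of the coset spaces, and
      \<open>\<Phi> g\<close> is translation by \<open>g\<close> on it. Only finitely many maps
      \<open>\<Phi> g\<close> exist, and each determines the coset of \<open>g\<close>.\<close>
    define D where "D = Sigma I (\<lambda>i. rcosets (K i))"
    define \<Phi> where "\<Phi> g = restrict (\<lambda>(i, Y). Y #> g) D" for g
    have "finite D" unfolding D_def using I K(2) by blast
    moreover have "\<Phi> ` carrier G \<subseteq> D \<rightarrow>\<^sub>E (\<Union>i\<in>I. rcosets (K i))"
    proof
      fix f assume "f \<in> \<Phi> ` carrier G"
      then obtain g where g: "g \<in> carrier G" "f = \<Phi> g" by blast
      have "Y #> g \<in> rcosets (K i)" if iY: "i \<in> I" "Y \<in> rcosets (K i)" for i Y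
      proof -
        obtain x where "x \<in> carrier G" "Y = K i #> x" using iY(2) unfolding RCOSETS_def by blast
        then show ?thesis
          using coset_mult_assoc[OF subgroup.subset[OF K(1)[OF iY(1)]]] g(1)
            rcosetsI[OF subgroup.subset[OF K(1)[OF iY(1)]]] by simp
      qed
      then show "f \<in> D \<rightarrow>\<^sub>E (\<Union>i\<in>I. rcosets (K i))"
        unfolding g(2) \<Phi>_def D_def by auto
    qed
    ultimately have fin: "finite (\<Phi> ` carrier G)"
      using I K(2) by (intro finite_subset[OF _ finite_PiE]) auto
    have eq: "N #> g = N #> g'" if g: "g \<in> carrier G" "g' \<in> carrier G" "\<Phi> g = \<Phi> g'" for g g'
    proof -
      have "x \<otimes> (g \<otimes> inv g') \<otimes> inv x \<in> K i" if "i \<in> I" "x \<in> carrier G" for i x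
      proof -
        note Ki = K(1)[OF that(1)]
        have "(i, K i #> x) \<in> D"
          unfolding D_def using that rcosetsI[OF subgroup.subset[OF Ki]] by blast
        then have "K i #> x #> g = K i #> x #> g'"
          using fun_cong[OF g(3), of "(i, K i #> x)"] unfolding \<Phi>_def by simp
        then have "K i #> (x \<otimes> g) = K i #> (x \<otimes> g')"
          using coset_mult_assoc[OF subgroup.subset[OF Ki]] that(2) g by simp
        then have "x \<otimes> g \<otimes> inv (x \<otimes> g') \<in> K i"
          using rcos_eq_iff[OF Ki] that(2) g by simp
        then show ?thesis using that(2) g by (simp add: m_assoc inv_mult_group)
      qed
      then have "g \<otimes> inv g' \<in> N" using g unfolding N_def by simp
      then show ?thesis using rcos_eq_iff[OF NG g(1,2)] by simp
    qed
    have "rcosets N = (\<lambda>g. N #> g) ` carrier G" unfolding RCOSETS_def by blast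
    also have "\<dots> \<subseteq> (\<lambda>f. N #> inv_into (carrier G) \<Phi> f) ` \<Phi> ` carrier G"
    proof
      fix Y assume "Y \<in> (\<lambda>g. N #> g) ` carrier G"
      then obtain g where g: "g \<in> carrier G" "Y = N #> g" by blast
      have "N #> g = N #> inv_into (carrier G) \<Phi> (\<Phi> g)"
        using g(1) by (intro eq) (auto simp: inv_into_into f_inv_into_f)
      then show "Y \<in> (\<lambda>f. N #> inv_into (carrier G) \<Phi> f) ` \<Phi> ` carrier G" using g by blast
    qed
    finally show ?thesis using fin finite_subset by blast
  qed
  ultimately show ?thesis by blast
qed

lemma set_mult_normal_subgroup:
  assumes C: "subgroup C G" and H: "H \<lhd> G"
  shows "subgroup (C <#> H) G"
proof (rule subgroupI)
  note HG = normal_imp_subgroup[OF H]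
  have c: "x \<in> C \<Longrightarrow> x \<in> carrier G" "x \<in> H \<Longrightarrow> x \<in> carrier G" for x
    using subgroup.mem_carrier[OF C] normal_carrier[OF H] by auto
  show "C <#> H \<subseteq> carrier G"
    using set_mult_closed[OF subgroup.subset[OF C] subgroup.subset[OF HG]] .
  show "C <#> H \<noteq> {}"
    using subgroup.one_closed[OF C] subgroup.one_closed[OF HG] unfolding set_mult_def by blast
  show "inv a \<in> C <#> H" if a: "a \<in> C <#> H" for a
  proof -
    obtain x h where xh: "x \<in> C" "h \<in> H" "a = x \<otimes> h" using a unfolding set_mult_def by blast
    have "x \<otimes> inv h \<otimes> inv x \<in> H"
      using xh c subgroup.m_inv_closed[OF HG] by (intro normal.inv_op_closed2[OF H]) auto
    moreover have "inv a = inv x \<otimes> (x \<otimes> inv h \<otimes> inv x)"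
      using xh c by (simp add: m_assoc inv_mult_group)
    ultimately show ?thesis
      using subgroup.m_inv_closed[OF C xh(1)] unfolding set_mult_def by blast
  qed
  show "a \<otimes> b \<in> C <#> H" if a: "a \<in> C <#> H" and b: "b \<in> C <#> H" for a b
  proof -
    obtain x h where xh: "x \<in> C" "h \<in> H" "a = x \<otimes> h" using a unfolding set_mult_def by blast
    obtain y k where yk: "y \<in> C" "k \<in> H" "b = y \<otimes> k" using b unfolding set_mult_def by blast
    have "inv y \<otimes> h \<otimes> y \<in> H"
      using xh yk c by (intro normal.inv_op_closed1[OF H]) auto
    then have "inv y \<otimes> h \<otimes> y \<otimes> k \<in> H" using yk(2) by (rule subgroup.m_closed[OF HG])
    moreover have "a \<otimes> b = x \<otimes> y \<otimes> (inv y \<otimes> h \<otimes> y \<otimes> k)"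
      using xh yk c by (simp add: m_assoc)
    ultimately show ?thesis
      using subgroup.m_closed[OF C xh(1) yk(1)] unfolding set_mult_def by blast
  qed
qed

lemma finite_rcosetsI:
  assumes K: "subgroup K G" and B: "finite B" "B \<subseteq> carrier G" "carrier G = (\<Union>b\<in>B. K #> b)"
  shows "finite (rcosets K)"
proof -
  have "rcosets K \<subseteq> (\<lambda>b. K #> b) ` B"
  proof
    fix Y assume "Y \<in> rcosets K"
    then obtain x where x: "x \<in> carrier G" "Y = K #> x" unfolding RCOSETS_def by blast
    then obtain b where "b \<in> B" "x \<in> K #> b" using B(3) by blast
    then show "Y \<in> (\<lambda>b. K #> b) ` B"
      using repr_independence[OF _ _ K, of x b] B(2) x by blast
  qed
  then show ?thesis using B(1) finite_surj by blast
qed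

end

section \<open>The ball estimate for trees of groups\<close>

context tree_of_groups
begin

text \<open>In a minimal generating subtree every edge gives a nontrivial amalgam, so each
  \<open>C e <#> H\<close> has finite index; a common normal core \<open>N\<close> then satisfies
  the hypotheses of \<open>commensurable_vertex_groups\<close>.\<close>

theorem normal_subgroup_ball_bound:
  assumes H: "H \<lhd> \<G>" and T: "finite T" "T \<subseteq> H" "generate \<G> T = H"
    and not_le: "\<And>e. e \<in> arcs \<X> \<Longrightarrow> \<not> H \<subseteq> C e"
    and S: "finite S" "S \<subseteq> carrier \<G>"
    and SA: "\<And>v. v \<in> V \<Longrightarrow> finite (SA v)" "\<And>v. v \<in> V \<Longrightarrow> SA v \<subseteq> A v"
      "\<And>v. v \<in> V \<Longrightarrow> generate \<G> (SA v) = A v"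
    and F: "mono F" "\<And>v n. v \<in> V \<Longrightarrow> A v \<inter> H \<inter> word_ball \<G> (SA v) n \<subseteq> word_ball \<G> T (F n)"
  shows "\<exists>K>0. \<forall>n>0. H \<inter> word_ball \<G> S n \<subseteq> word_ball \<G> T (K * n * F (K * n) + K * n)"
proof -
  obtain Y where Y: "generating_subtree Y" "\<And>Z. Z \<subset> Y \<Longrightarrow> \<not> generating_subtree Z"
    using minimal_generating_subtree by blast
  have YV: "Y \<subseteq> V" and Y0: "Y \<noteq> {}" and Yconn: "\<And>u v. u \<in> Y \<Longrightarrow> v \<in> Y \<Longrightarrow> (u, v) \<in> (steps Y {})\<^sup>*"
    and Ygen: "generate \<G> (\<Union>v\<in>Y. A v) = carrier \<G>"
    using Y(1) unfolding generating_subtree_def by auto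
  define I where "I = {e \<in> arcs \<X>. head \<X> e \<in> Y \<and> tail \<X> e \<in> Y}"
  define K where "K e = C e <#>\<^bsub>\<G>\<^esub> H" for e
  have I: "finite I" unfolding I_def by simp
  have K: "subgroup (K e) \<G>" if "e \<in> I" for e
    unfolding K_def using that by (intro G.set_mult_normal_subgroup C_subgroup H) (simp add: I_def)
  have K_fin: "finite (rcosets\<^bsub>\<G>\<^esub> (K e))" if e: "e \<in> I" for e
  proof -
    have e': "e \<in> arcs \<X>" "head \<X> e \<in> Y" "tail \<X> e \<in> Y" using e unfolding I_def by auto
    interpret P: amalgam \<G> "side e" "C e" by (rule edge_amalgam[OF e'(1)])
    obtain B where "finite B" "B \<subseteq> carrier \<G>" "carrier \<G> = (\<Union>b\<in>B. K e #>\<^bsub>\<G>\<^esub> b)"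
      using P.finite_double_cosets[OF H T not_le[OF e'(1)] side_neq_C[OF Y e']] unfolding K_def by blast
    then show ?thesis by (rule G.finite_rcosetsI[OF K[OF e]])
  qed
  have H_le: "H \<subseteq> K e" if "e \<in> I" for e
  proof
    fix h assume h: "h \<in> H"
    have "\<one>\<^bsub>\<G>\<^esub> \<in> C e" using that C_subgroup subgroup.one_closed unfolding I_def by blast
    moreover have "h = \<one>\<^bsub>\<G>\<^esub> \<otimes>\<^bsub>\<G>\<^esub> h" using G.normal_carrier[OF H h] by simp
    ultimately show "h \<in> K e" unfolding K_def set_mult_def using h by blast
  qed
  obtain N where N: "N \<lhd> \<G>" "finite (rcosets\<^bsub>\<G>\<^esub> N)" "H \<subseteq> N" "\<And>e. e \<in> I \<Longrightarrow> N \<subseteq> K e"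
    using G.normal_core_finite_index[of I K H, OF I K K_fin H H_le] by blast
  have N_edge: "N \<subseteq> (A u \<inter> A v) <#>\<^bsub>\<G>\<^esub> H" if uv: "(u, v) \<in> steps Y {}" for u v
  proof -
    obtain e where e: "e \<in> arcs \<X>" "u = tail \<X> e" "v = head \<X> e" "e \<in> I"
      using uv unfolding steps_def I_def by blast
    have "K e \<subseteq> (A u \<inter> A v) <#>\<^bsub>\<G>\<^esub> H"
      unfolding K_def using C_le_A_head[OF e(1)] C_le_A_tail[OF e(1)] e(2,3)
      by (intro mono_set_mult) auto
    then show ?thesis using N(4)[OF e(4)] by blast
  qed
  have N_vertex: "N \<subseteq> A v <#>\<^bsub>\<G>\<^esub> H" if v: "v \<in> Y" for v
  proof (cases "Y = {v}")
    \<comment> \<open>A single vertex has no edge to supply the condition, but then its vertex group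
      is the whole group.\<close>
    case True
    have "generate \<G> (A v) \<subseteq> A v"
      using G.generate_subgroup_incl[OF order_refl A_subgroup] v YV by blast
    then have "generate \<G> (A v) = A v" by (blast intro: generate.incl)
    then have "A v = carrier \<G>" using Ygen True by simp
    then have "n \<in> A v <#>\<^bsub>\<G>\<^esub> H" if "n \<in> N" for n
    proof -
      have "n = n \<otimes>\<^bsub>\<G>\<^esub> \<one>\<^bsub>\<G>\<^esub>" "n \<in> carrier \<G>" using G.normal_carrier[OF N(1) that] by simp_all
      then show ?thesis
        using \<open>A v = carrier \<G>\<close> subgroup.one_closed[OF normal_imp_subgroup[OF H]]
        unfolding set_mult_def by blast
    qed
    then show ?thesis by blast
  next
    case False
    then obtain w where "w \<in> Y" "w \<noteq> v" using v by blast
    \<comment> \<open>By connectedness, a vertex of a larger subtree has an adjacent vertex, and the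
      condition on that edge implies the one on the vertex.\<close>
    then obtain u where "(v, u) \<in> steps Y {}" using Yconn[OF v] by (metis converse_rtranclE)
    from N_edge[OF this] show ?thesis
      using mono_set_mult[of "A v \<inter> A u" "A v" H H \<G>] by blast
  qed
  interpret M: commensurable_vertex_groups \<G> H N T Y A SA "steps Y {}" F
  proof (intro commensurable_vertex_groups.intro commensurable_vertex_groups_axioms.intro G.is_group)
    show "finite Y" using YV X.finite_verts finite_subset by blast
    show "generate \<G> (\<Union>v\<in>Y. SA v) = carrier \<G>"
    proof
      have sub: "(\<Union>v\<in>Y. SA v) \<subseteq> carrier \<G>" using SA(2) A_carrier YV by blast
      show "generate \<G> (\<Union>v\<in>Y. SA v) \<subseteq> carrier \<G>" using G.generate_in_carrier[OF sub] by blast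
      have "A v \<subseteq> generate \<G> (\<Union>v\<in>Y. SA v)" if "v \<in> Y" for v
        using G.mono_generate[of "SA v" "\<Union>v\<in>Y. SA v"] SA(3)[of v] that YV by blast
      then have "(\<Union>v\<in>Y. A v) \<subseteq> generate \<G> (\<Union>v\<in>Y. SA v)" by blast
      from G.generate_subgroup_incl[OF this G.generate_is_subgroup[OF sub]]
      show "carrier \<G> \<subseteq> generate \<G> (\<Union>v\<in>Y. SA v)" using Ygen by simp
    qed
    show "u \<in> Y" "v \<in> Y" if "(u, v) \<in> steps Y {}" for u v
      using that unfolding steps_def by auto
    show "SA v \<subseteq> A v" "A v \<inter> H \<inter> word_ball \<G> (SA v) n \<subseteq> word_ball \<G> T (F n)" if "v \<in> Y" for v n
      using SA(2) F(2) that YV by blast+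
  qed (use H N(1-3) T Y0 A_subgroup SA F YV N_vertex N_edge Yconn in auto)
  obtain K0 where K0: "K0 > 0" "\<And>n. n > 0 \<Longrightarrow> H \<inter> word_ball \<G> M.\<Sigma> n \<subseteq> word_ball \<G> T (n * M.bound K0 n)"
    using M.distortion_bound by blast
  obtain L where L: "L > 0" "\<And>n. word_ball \<G> S n \<subseteq> word_ball \<G> M.\<Sigma> (L * n)"
    using G.word_ball_lipschitz[OF M.\<Sigma>(2) S(1)] S(2) M.generates by blast
  have "H \<inter> word_ball \<G> S n \<subseteq> word_ball \<G> T (K0 * L * n * F (K0 * L * n) + K0 * L * n)" if "n > 0" for n
  proof -
    have "L * n * M.bound K0 (L * n) = K0 * L * n * F (K0 * L * n) + K0 * L * n"
      unfolding M.bound_def by (simp add: algebra_simps)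
    then show ?thesis using K0(2)[of "L * n"] L(2)[of n] L(1) that by auto
  qed
  then show ?thesis using K0(1) L(1) by (intro exI[of _ "K0 * L"]) auto
qed

end

section \<open>Distortion as a natural number and its relation to balls\<close>

definition nat_distortion ::
  "('a, 'b) monoid_scheme \<Rightarrow> 'a set \<Rightarrow> 'a set \<Rightarrow> 'a set \<Rightarrow> real \<Rightarrow> nat" where
  "nat_distortion G S H T r = Max {word_length G T h | h. h \<in> H \<and> real (word_length G S h) \<le> r}"

lemma distortion_eq: "distortion G S H T r = of_nat (nat_distortion G S H T r)"
  unfolding distortion_def nat_distortion_def ..

context group
begin

context
  fixes S H T K :: "'a set"
  assumes S: "finite S" "S \<subseteq> carrier G" "generate G S = K"
    and H: "subgroup H G" "H \<subseteq> K"
begin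

lemma finite_distortion_set:
  "finite {word_length G T h | h. h \<in> H \<and> real (word_length G S h) \<le> r}"
proof -
  have "{word_length G T h | h. h \<in> H \<and> real (word_length G S h) \<le> r} \<subseteq>
      word_length G T ` word_ball G S (nat \<lfloor>r\<rfloor>)"
  proof clarify
    fix h assume h: "h \<in> H" "real (word_length G S h) \<le> r"
    \<comment> \<open>Word lengths are integers, so a real radius may be replaced by its
      floor.\<close>
    have "word_length G S h \<le> nat \<lfloor>r\<rfloor>" using h(2) by linarith
    then have "h \<in> word_ball G S (nat \<lfloor>r\<rfloor>)"
      using word_length_le_iff[OF S(2)] S(3) H(2) h(1) by blast
    then show "word_length G T h \<in> word_length G T ` word_ball G S (nat \<lfloor>r\<rfloor>)" by blast
  qed
  then show ?thesis using finite_word_ball[OF S(1)] finite_surj by blast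
qed

lemma distortion_set_nonempty:
  assumes "r \<ge> 0"
  shows "{word_length G T h | h. h \<in> H \<and> real (word_length G S h) \<le> r} \<noteq> {}"
proof -
  have "word_length G S \<one> \<le> 0" by (rule word_length_le[OF one_in_word_ball])
  then show ?thesis using subgroup.one_closed[OF H(1)] assms by auto
qed

lemma nat_distortion_mono:
  assumes "0 \<le> r" "r \<le> r'"
  shows "nat_distortion G S H T r \<le> nat_distortion G S H T r'"
  unfolding nat_distortion_def
  using assms by (intro Max_mono finite_distortion_set distortion_set_nonempty) auto

lemma word_length_le_nat_distortion:
  "h \<in> H \<Longrightarrow> h \<in> word_ball G S n \<Longrightarrow> word_length G T h \<le> nat_distortion G S H T (real n)"
  unfolding nat_distortion_def using word_length_le[of h S n]
  by (intro Max_ge finite_distortion_set) auto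

lemma nat_distortion_leI:
  assumes "r \<ge> 0" "H \<inter> word_ball G S (nat \<lfloor>r\<rfloor>) \<subseteq> word_ball G T m"
  shows "nat_distortion G S H T r \<le> m"
  unfolding nat_distortion_def
proof (rule Max.boundedI[OF finite_distortion_set distortion_set_nonempty[OF assms(1)]], clarify)
  fix h assume h: "h \<in> H" "real (word_length G S h) \<le> r"
  have "word_length G S h \<le> nat \<lfloor>r\<rfloor>" using h(2) by linarith
  then have "h \<in> word_ball G S (nat \<lfloor>r\<rfloor>)"
    using word_length_le_iff[OF S(2)] S(3) H(2) h(1) by blast
  then show "word_length G T h \<le> m" using assms(2) h(1) word_length_le by blast
qed

end

end

theorem corollary1p4:
  fixes \<Gamma> :: "('v, 'e, 'g, 'h) graph_of_groups"
    and G :: "('v, 'e, 'g) letter list set monoid"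
    and A :: "'v \<Rightarrow> ('v, 'e, 'g) letter list set set"
    and H S T :: "('v, 'e, 'g) letter list set set"
    and S_A T_A :: "'v \<Rightarrow> ('v, 'e, 'g) letter list set set"
  assumes "simply_connected_finite_graph_of_groups \<Gamma>"
    and "\<And>v. v \<in> verts (graph_of \<Gamma>) \<Longrightarrow>
           finitely_generated (vertex_group \<Gamma> v) (carrier (vertex_group \<Gamma> v))"
    and "\<And>e. e \<in> arcs (graph_of \<Gamma>) \<Longrightarrow>
           finitely_generated (edge_group \<Gamma> e) (carrier (edge_group \<Gamma> e))"
    and "G = tree_pi1 \<Gamma>"
    and "A = vertex_subgroup \<Gamma>"
    and "H \<lhd> G"
    and "finitely_generated G H"
    and "\<And>e. e \<in> arcs (graph_of \<Gamma>) \<Longrightarrow> \<not> H \<subseteq> edge_subgroup \<Gamma> e"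
    and "\<And>v. v \<in> verts (graph_of \<Gamma>) \<Longrightarrow> finitely_generated G (A v \<inter> H)"
    and "finite_generating_set G (carrier G) S"
    and "finite_generating_set G H T"
    and "\<And>v. v \<in> verts (graph_of \<Gamma>) \<Longrightarrow> finite_generating_set G (A v) (S_A v)"
    and "\<And>v. v \<in> verts (graph_of \<Gamma>) \<Longrightarrow> finite_generating_set G (A v \<inter> H) (T_A v)"
  shows "dominated (distortion G S H T)
           (\<lambda>n. ennreal n *
              Max {distortion G (S_A v) (A v \<inter> H) (T_A v) n | v. v \<in> verts (graph_of \<Gamma>)})"
proof -
  interpret \<Gamma>: tree_of_groups \<Gamma> by unfold_locales (rule assms(1))
  interpret G: group G unfolding assms(4) by (rule \<Gamma>.G.is_group)
  note gen = finite_generating_set_def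
  let ?V = "verts (graph_of \<Gamma>)"
  have HG: "subgroup H G" using assms(6) by (rule normal_imp_subgroup)
  have S: "finite S" "S \<subseteq> carrier G" "generate G S = carrier G" using assms(10) by (auto simp: gen)
  have T: "finite T" "T \<subseteq> H" "generate G T = H" using assms(11) unfolding gen by blast+
  have Tc: "T \<subseteq> carrier G" using T(2) subgroup.subset[OF HG] by blast
  have SA: "finite (S_A v)" "S_A v \<subseteq> A v" "generate G (S_A v) = A v"
    and TA: "finite (T_A v)" "T_A v \<subseteq> A v \<inter> H" "generate G (T_A v) = A v \<inter> H" if "v \<in> ?V" for v
    using assms(12,13)[OF that] unfolding gen by blast+
  have A: "subgroup (A v) G" if "v \<in> ?V" for v using \<Gamma>.A_subgroup[OF that] unfolding assms(4,5) .
  have AH: "subgroup (A v \<inter> H) G" if "v \<in> ?V" for v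
    using G.subgroups_Inter_pair[OF A[OF that] HG] .
  have SAc: "S_A v \<subseteq> carrier G" and TAc: "T_A v \<subseteq> carrier G" if "v \<in> ?V" for v
    using SA(2)[OF that] TA(2)[OF that] subgroup.subset[OF A[OF that]] by blast+
  define d where "d v = nat_distortion G (S_A v) (A v \<inter> H) (T_A v)" for v
  define \<Delta> where "\<Delta> r = Max ((\<lambda>v. d v r) ` ?V)" for r
  have finV: "finite ?V" and V0: "?V \<noteq> {}" using \<Gamma>.V_connected(1) by auto
  have d_le: "d v r \<le> \<Delta> r" if "v \<in> ?V" for v r
    unfolding \<Delta>_def using finV that by (intro Max_ge) auto
  have d_mono: "d v r \<le> d v r'" if "v \<in> ?V" "0 \<le> r" "r \<le> r'" for v r r'
    unfolding d_def
    by (rule G.nat_distortion_mono[OF SA(1)[OF that(1)] SAc[OF that(1)] SA(3)[OF that(1)] AH[OF that(1)] _ that(2,3)])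
      blast
  have \<Delta>_mono: "\<Delta> r \<le> \<Delta> r'" if "0 \<le> r" "r \<le> r'" for r r'
  proof -
    have "d v r \<le> \<Delta> r'" if "v \<in> ?V" for v
      using d_mono[OF that \<open>0 \<le> r\<close> \<open>r \<le> r'\<close>] d_le[OF that, of r'] by linarith
    then show ?thesis unfolding \<Delta>_def[of r] using finV V0 by (intro Max.boundedI) auto
  qed
  have \<Delta>_le: "of_nat (\<Delta> r) \<le> Max {distortion G (S_A v) (A v \<inter> H) (T_A v) r | v. v \<in> ?V}" for r
  proof -
    have "\<Delta> r \<in> (\<lambda>v. d v r) ` ?V" unfolding \<Delta>_def using finV V0 by (intro Max_in) auto
    then obtain v where v: "v \<in> ?V" "\<Delta> r = d v r" by blast
    have "{distortion G (S_A v) (A v \<inter> H) (T_A v) r | v. v \<in> ?V} =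
        (\<lambda>v. distortion G (S_A v) (A v \<inter> H) (T_A v) r) ` ?V" by blast
    then show ?thesis
      using finV v by (auto simp: distortion_eq d_def intro!: Max_ge)
  qed
  \<comment> \<open>The vertex distortions count letters of \<open>T_A v\<close>, whereas lengths in
    \<open>H\<close> are measured by \<open>T\<close>; one constant converts between them for all
    vertices.\<close>
  have "\<exists>M. \<forall>v\<in>W. \<forall>n. word_ball G (T_A v) n \<subseteq> word_ball G T (M * n)" if "finite W" "W \<subseteq> ?V" for W
    using that
  proof (induction rule: finite_induct)
    case (insert v W)
    then obtain M where M: "\<forall>v\<in>W. \<forall>n. word_ball G (T_A v) n \<subseteq> word_ball G T (M * n)" by auto
    have v: "v \<in> ?V" using insert.prems by blast
    have "T_A v \<subseteq> generate G T" using TA(2)[OF v] T(3) by blast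
    from G.word_ball_lipschitz[OF Tc TA(1)[OF v] this]
    obtain M' where M': "\<And>n. word_ball G (T_A v) n \<subseteq> word_ball G T (M' * n)" by blast
    have "word_ball G T (M * n) \<subseteq> word_ball G T ((M + M') * n)"
      "word_ball G T (M' * n) \<subseteq> word_ball G T ((M + M') * n)" for n
      by (intro G.word_ball_mono; simp)+
    then show ?case using M M' by (intro exI[of _ "M + M'"]) blast
  qed simp
  from this[OF finV order_refl] obtain M where
    M: "\<And>v n. v \<in> ?V \<Longrightarrow> word_ball G (T_A v) n \<subseteq> word_ball G T (M * n)" by blast
  define F where "F n = M * \<Delta> (real n)" for n
  have F_mono: "mono F" unfolding F_def mono_def by (auto intro!: mult_left_mono \<Delta>_mono)
  have F: "A v \<inter> H \<inter> word_ball G (S_A v) n \<subseteq> word_ball G T (F n)" if v: "v \<in> ?V" for v n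
  proof
    fix h assume h: "h \<in> A v \<inter> H \<inter> word_ball G (S_A v) n"
    have "word_length G (T_A v) h \<le> d v (real n)"
      unfolding d_def using h
      by (intro G.word_length_le_nat_distortion[OF SA(1)[OF v] SAc[OF v] SA(3)[OF v] AH[OF v]]) auto
    also have "\<dots> \<le> \<Delta> (real n)" by (rule d_le[OF v])
    finally have "h \<in> word_ball G (T_A v) (\<Delta> (real n))"
      using G.word_length_le_iff[OF TAc[OF v]] TA(3)[OF v] h by blast
    then show "h \<in> word_ball G T (F n)" unfolding F_def using M[OF v] by blast
  qed
  obtain K where K: "K > 0"
    "\<And>n. n > 0 \<Longrightarrow> H \<inter> word_ball G S n \<subseteq> word_ball G T (K * n * F (K * n) + K * n)"
    using \<Gamma>.normal_subgroup_ball_bound[of H T S S_A F] assms(6,8) T S(1,2) SA F_mono F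
    unfolding assms(4,5) by blast
  show ?thesis
    unfolding dominated_def
  \<comment> \<open>The four constants are read off from the final inequality: \<open>Suc M\<close>
    outside, \<open>real K\<close> both inside and in the linear term, and the threshold 1, which
    makes the floor of \<open>x\<close> positive.\<close>
  proof (intro exI conjI allI impI)
    fix x :: real
    assume x: "x > 1"
    let ?n = "nat \<lfloor>x\<rfloor>"
    let ?Max = "Max {distortion G (S_A v) (A v \<inter> H) (T_A v) (real K * x) | v. v \<in> ?V}"
    have n: "?n > 0" "real ?n \<le> x" using x by linarith+
    have Kn: "real (K * ?n) \<le> real K * x" using n(2) by (simp add: mult_left_mono)
    have "nat_distortion G S H T x \<le> K * ?n * F (K * ?n) + K * ?n"
      using x subgroup.subset[OF HG] by (intro G.nat_distortion_leI[OF S HG] K(2) n(1)) auto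
    \<comment> \<open>Passing from \<open>M\<close> to \<open>Suc M\<close> makes the outer constant
      positive, as domination demands.\<close>
    also have "K * ?n * F (K * ?n) + K * ?n \<le> Suc M * (K * ?n * \<Delta> (real (K * ?n))) + K * ?n"
      unfolding F_def by simp
    finally have "distortion G S H T x \<le>
        of_nat (Suc M * (K * ?n * \<Delta> (real (K * ?n))) + K * ?n)"
      unfolding distortion_eq of_nat_le_iff .
    also have "\<dots> = of_nat (Suc M) * (of_nat (K * ?n) * of_nat (\<Delta> (real (K * ?n)))) + of_nat (K * ?n)"
      by (simp only: of_nat_add of_nat_mult)
    also have "\<dots> \<le> ennreal (real (Suc M)) * (ennreal (real K * x) * ?Max) + ennreal (real K * x)"
    proof (intro add_mono mult_mono)
      show "of_nat (K * ?n) \<le> ennreal (real K * x)" "of_nat (K * ?n) \<le> ennreal (real K * x)"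
        using ennreal_leI[OF Kn] by (simp_all only: ennreal_of_nat_eq_real_of_nat)
      have "\<Delta> (real (K * ?n)) \<le> \<Delta> (real K * x)" by (rule \<Delta>_mono[OF _ Kn]) simp
      then have "(of_nat (\<Delta> (real (K * ?n))) :: ennreal) \<le> of_nat (\<Delta> (real K * x))" by simp
      also have "\<dots> \<le> ?Max" by (rule \<Delta>_le)
      finally show "of_nat (\<Delta> (real (K * ?n))) \<le> ?Max" .
    qed (simp_all only: ennreal_of_nat_eq_real_of_nat zero_le order_refl)
    finally show "distortion G S H T x \<le>
      ennreal (real (Suc M)) * (ennreal (real K * x) * ?Max) + ennreal (real K * x)" .
  qed (use K(1) in simp_all)
qed

end
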